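(* Let $n=3$ or $n=2$, let $w,c,p_{1},p_{2},\alpha_{1},\alpha_{2}$ be non-zero complex constants with $\alpha_{1}\neq\alpha_{2}$, let $q\not\equiv 0$ be a polynomial and let $Q$ be a non-constant polynomial. Suppose $f$ is a transcendental entire function of finite order which is a solution of the differential-difference equation $$f^{n}(z)+wf^{n-1}(z)f'(z)+q(z)e^{Q(z)}f(z+c)=p_{1}e^{\alpha_{1}z}+p_{2}e^{\alpha_{2}z}$$ and which satisfies $\lambda(f)<\rho(f)$. Then the following conclusions hold: (i) Each such solution $f$ satisfies $\rho(f)=\deg Q=1$. (ii) If $n\geq 1$ and $f$ is a solution which belongs to $\Gamma_{0}=\{e^{\alpha(z)}:\alpha(z)\text{ is a non-constant polynomial}\}$, then either $$f(z)=e^{(\alpha_{2}z/n)+\beta},\qquad Q(z)=\left(\alpha_{1}-\frac{\alpha_{2}}{n}\right)z+b,$$ or $$f(z)=e^{(\alpha_{1}z/n)+\beta},\qquad Q(z)=\left(\alpha_{2}-\frac{\alpha_{1}}{n}\right)z+b,$$ where $\beta$ and $b$ are constants.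
   Context: Standard Nevanlinna theory notation: $T(r,f)$ is the characteristic function, and $n(r,1/f)$ is the un-integrated counting function of the zeros of $f$. The order of growth of $f$ is $\rho(f)=\limsup_{r\to\infty}\frac{\log^{+}T(r,f)}{\log r}$ (finite order means $\rho(f)<\infty$), and the exponent of convergence (of zeros) is $\lambda(f)=\limsup_{r\to\infty}\frac{\log^{+}n(r,1/f)}{\log r}$. Here $f^{n}$ denotes the $n$-th power of $f$. *)

theory Defs
  imports "HOL-Complex_Analysis.Complex_Analysis"
begin

definition log_plus :: "real \<Rightarrow> real" where
  "log_plus x = max 0 (ln x)"

(* Poles in the closed disc, with multiplicity; the order of a pole is - zorder.
   A zero of f is a pole (in the sense of is_pole) of \<lambda>z. 1 / f z, irrespective of the
   value that division by zero assigns to that function at the point itself. *)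
definition pole_count :: "real \<Rightarrow> (complex \<Rightarrow> complex) \<Rightarrow> nat" where
  "pole_count r f = (\<Sum>z | norm z \<le> r \<and> is_pole f z. nat (- zorder f z))"

definition integrated_pole_count :: "real \<Rightarrow> (complex \<Rightarrow> complex) \<Rightarrow> real" where
  "integrated_pole_count r f =
     integral {0..r} (\<lambda>t. (real (pole_count t f) - real (pole_count 0 f)) / t)
       + real (pole_count 0 f) * ln r"

definition proximity :: "real \<Rightarrow> (complex \<Rightarrow> complex) \<Rightarrow> real" where
  "proximity r f =
     1 / (2 * pi) * integral {0..2 * pi} (\<lambda>\<theta>. log_plus (norm (f (of_real r * cis \<theta>))))"

definition nevanlinna_char :: "real \<Rightarrow> (complex \<Rightarrow> complex) \<Rightarrow> real" where
  "nevanlinna_char r f = proximity r f + integrated_pole_count r f"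

definition growth_order :: "(complex \<Rightarrow> complex) \<Rightarrow> ereal" where
  "growth_order f = Limsup at_top (\<lambda>r::real. ereal (log_plus (nevanlinna_char r f) / ln r))"

definition zero_exponent :: "(complex \<Rightarrow> complex) \<Rightarrow> ereal" where
  "zero_exponent f =
     Limsup at_top (\<lambda>r::real. ereal (log_plus (real (pole_count r (\<lambda>z. 1 / f z))) / ln r))"

definition transcendental_entire :: "(complex \<Rightarrow> complex) \<Rightarrow> bool" where
  "transcendental_entire f \<longleftrightarrow> f holomorphic_on UNIV \<and> (\<nexists>p. f = poly p)"

definition \<Gamma>\<^sub>0 :: "(complex \<Rightarrow> complex) set" where
  "\<Gamma>\<^sub>0 = {\<lambda>z. exp (poly a z) | a. degree a > 0}"

end

theory Submission
  imports Defs "HOL-Real_Asymp.Real_Asymp"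
begin

text \<open>
  The hypothesis \<open>\<lambda>(f) < \<rho>(f) < \<infinity>\<close> makes \<open>f\<close> look like an exponential. By Hadamard's theorem
  (\<open>Hadamard_factorization\<close>) \<open>f = H exp a\<close> with a polynomial \<open>a\<close> and an entire function \<open>H\<close> whose
  growth is strictly below \<open>\<rho>(f)\<close>; consequently \<open>\<rho>(f) = degree a\<close> (\<open>growth_order_eq_degree\<close>). Substituted into the
  equation, this gives a linear relation
  \<open>A exp (n a) + q(z) H(z + c) exp (Q(z) + a(z + c)) = p\<^sub>1 exp (\<alpha>\<^sub>1 z) + p\<^sub>2 exp (\<alpha>\<^sub>2 z)\<close>
  between exponentials of polynomials whose coefficients grow more slowly than the exponentials. Such
  relations are governed by Borel's theorem (\<open>Borel_exponential_independence\<close>): a summand whose exponent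
  differs from all others by polynomials of large degree has coefficient zero. If \<open>degree a \<ge> 2\<close>, the
  right-hand side is a coefficient of slow growth, and Borel's theorem forces \<open>A = 0\<close>, that is
  \<open>f + w f' = 0\<close>, contradicting the order of \<open>f\<close>. So \<open>f\<close> has order one, and comparing growth once more gives
  \<open>degree Q = 1\<close> (\<open>order_one_of_difference_equation\<close>). If \<open>f = exp a\<close>, all coefficients are polynomials,
  and Borel's theorem pairs \<open>\<alpha>\<^sub>1 z\<close> and \<open>\<alpha>\<^sub>2 z\<close> with \<open>n a\<close> and \<open>Q(z) + a(z + c)\<close> in one of two ways
  (\<open>exponential_solution_of_difference_equation\<close>).

  Growth is measured throughout by the class \<open>growth_le s\<close> of entire functions with
  \<open>log \<bar>f(z)\<bar> = O((1 + \<bar>z\<bar>)\<^sup>s)\<close>. It is a differential ring, closed under translations, and, which is the decisive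
  property, closed under exact division (\<open>growth_le_quotient\<close>). Division is what produces the polynomial
  in Hadamard's theorem and what drives Borel's theorem. Its proof is the easy half of Nevanlinna's
  first fundamental theorem: on a circle the mean of \<open>log \<bar>G\<bar>\<close> is at least \<open>log \<bar>G(0)\<bar>\<close>, so the mean of
  \<open>log\<^sup>+ \<bar>1/G\<bar>\<close> is at most that of \<open>log\<^sup>+ \<bar>G\<bar>\<close> up to a constant. This mean value inequality, and the passage from
  means over circles to pointwise bounds, both come from dominating a continuous function on a circle by
  the real part of a polynomial, to which the maximum principle and the Schwarz lemma apply
  (\<open>norm_centre_le_exp_circle_mean\<close>, \<open>norm_le_exp_circle_mean\<close>).
\<close>

section \<open>Circle means and harmonic majorants\<close>

definition circle_mean :: "real \<Rightarrow> (complex \<Rightarrow> real) \<Rightarrow> real" where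
  "circle_mean R u = 1 / (2 * pi) * integral {0..2 * pi} (\<lambda>\<theta>. u (of_real R * cis \<theta>))"

lemma integrable_on_circle:
  assumes "continuous_on (sphere 0 R) u" "R \<ge> 0"
  shows "(\<lambda>t. u (of_real R * cis t) :: 'a::euclidean_space) integrable_on {a..b}"
proof (rule integrable_continuous_interval)
  show "continuous_on {a..b} (\<lambda>t. u (of_real R * cis t))"
    by (rule continuous_on_compose2[OF assms(1)])
       (use assms(2) in \<open>auto intro!: continuous_intros simp: norm_mult\<close>)
qed

lemma circle_mean_const [simp]: "circle_mean R (\<lambda>_. c) = c"
  by (simp add: circle_mean_def)

lemma circle_mean_mono:
  assumes "continuous_on (sphere 0 R) u" "continuous_on (sphere 0 R) v" "R \<ge> 0"
    and "\<And>z. norm z = R \<Longrightarrow> u z \<le> v z"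
  shows "circle_mean R u \<le> circle_mean R v"
  unfolding circle_mean_def
  using assms by (intro mult_left_mono integral_le integrable_on_circle) (auto simp: norm_mult)

lemma circle_mean_add:
  assumes "continuous_on (sphere 0 R) u" "continuous_on (sphere 0 R) v" "R \<ge> 0"
  shows "circle_mean R (\<lambda>z. u z + v z) = circle_mean R u + circle_mean R v"
  unfolding circle_mean_def
  by (subst integral_add) (use assms integrable_on_circle in \<open>auto simp: distrib_left add_divide_distrib\<close>)

lemma circle_mean_diff:
  assumes "continuous_on (sphere 0 R) u" "continuous_on (sphere 0 R) v" "R \<ge> 0"
  shows "circle_mean R (\<lambda>z. u z - v z) = circle_mean R u - circle_mean R v"
  unfolding circle_mean_def
  by (subst integral_diff) (use assms integrable_on_circle in \<open>auto simp: right_diff_distrib diff_divide_distrib\<close>)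

text \<open>
  Writing \<open>p = a + z p'\<close>, the part \<open>z p'(z)\<close> is the derivative along the circle of a multiple of a
  primitive of \<open>p'\<close>, so it integrates to zero over a full turn.
\<close>
lemma circle_mean_Re_poly:
  assumes "R \<ge> 0"
  shows "circle_mean R (\<lambda>z. Re (poly p z)) = Re (poly p 0)"
proof (cases p)
  case (pCons a p')
  obtain G where G: "\<And>z. (G has_field_derivative poly p' z) (at z)"
  proof -
    have "poly p' holomorphic_on UNIV" by (intro holomorphic_intros)
    thus ?thesis using holomorphic_convex_primitive'[of UNIV "poly p'"] that by auto
  qed
  define z where "z = (\<lambda>t. of_real R * cis t)"
  have "((\<lambda>t. z t * poly p' (z t)) has_integral (-\<i> * G (z (2*pi)) - (-\<i> * G (z 0)))) {0..2*pi}"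
  proof (rule fundamental_theorem_of_calculus)
    fix t :: real
    have "(cis has_vector_derivative \<i> * cis t) (at t within {0..2*pi})"
      by (auto simp: has_vector_derivative_def scaleR_conv_of_real intro!: derivative_eq_intros)
    hence "(z has_vector_derivative of_real R * (\<i> * cis t)) (at t within {0..2*pi})"
      unfolding z_def by (rule has_vector_derivative_mult_right)
    hence "(G \<circ> z has_vector_derivative (of_real R * (\<i> * cis t)) * poly p' (z t)) (at t within {0..2*pi})"
      by (rule field_vector_diff_chain_within) (use G has_field_derivative_at_within in blast)
    hence "((\<lambda>t. -\<i> * (G \<circ> z) t) has_vector_derivative
             -\<i> * ((of_real R * (\<i> * cis t)) * poly p' (z t))) (at t within {0..2*pi})"
      by (rule has_vector_derivative_mult_right)
    thus "((\<lambda>t. -\<i> * G (z t)) has_vector_derivative z t * poly p' (z t)) (at t within {0..2*pi})"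
      by (simp add: z_def o_def mult_ac)
  qed auto
  moreover have "z (2*pi) = z 0" by (simp add: z_def)
  ultimately have "((\<lambda>t. z t * poly p' (z t)) has_integral 0) {0..2*pi}" by simp
  from has_integral_add[OF this has_integral_const_real[of a 0 "2*pi"]]
  have "((\<lambda>t. poly p (z t)) has_integral (2 * pi) *\<^sub>R a) {0..2*pi}"
    by (simp add: pCons add.commute)
  from has_integral_linear[OF this bounded_linear_Re]
  have "((\<lambda>t. Re (poly p (z t))) has_integral 2 * pi * Re a) {0..2*pi}" by (simp add: o_def)
  thus ?thesis
    by (simp add: circle_mean_def z_def pCons integral_unique)
qed

text \<open>
  On the circle \<open>\<bar>z\<bar> = R\<close> one has \<open>z cnj z = R\<^sup>2\<close>, so every mixed monomial in \<open>z\<close> and \<open>cnj z\<close> collapses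
  to a power of one of them. This is what makes the real parts of polynomials an algebra on the circle.
\<close>
lemma Re_poly_times_cnj_on_circle:
  fixes p q :: "complex poly"
  shows "\<exists>r. \<forall>z::complex. norm z = R \<longrightarrow> Re (poly p z * cnj (poly q z)) = Re (poly r z)"
proof (induction p arbitrary: q)
  case 0
  show ?case by (intro exI[of _ 0]) auto
next
  case (pCons a p)
  obtain b q' where q: "q = pCons b q'" by (cases q)
  obtain r where r: "\<And>z. norm z = R \<Longrightarrow> Re (poly p z * cnj (poly q' z)) = Re (poly r z)"
    using pCons.IH[of q'] by blast
  define r' where "r' = smult (cnj a) q + smult (cnj b) (pCons 0 p) + smult (of_real (R\<^sup>2)) r"
  show ?case
  proof (intro exI[of _ r'] allI impI)
    fix z :: complex assume z: "norm z = R"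
    have "z * cnj z = of_real (R\<^sup>2)"
      using z by (metis complex_norm_square)
    hence "poly (pCons a p) z * cnj (poly q z) =
        a * cnj (poly q z) + cnj b * (z * poly p z) + of_real (R\<^sup>2) * (poly p z * cnj (poly q' z))"
      by (simp add: q) (simp add: algebra_simps)
    also have "Re \<dots> = Re (cnj a * poly q z) + Re (cnj b * (z * poly p z)) + R\<^sup>2 * Re (poly p z * cnj (poly q' z))"
      by (simp only: plus_complex.sel Re_complex_of_real) (simp add: power2_eq_square)
    also have "\<dots> = Re (poly r' z)"
      using r[OF z] by (simp add: r'_def algebra_simps)
    finally show "Re (poly (pCons a p) z * cnj (poly q z)) = Re (poly r' z)" .
  qed
qed

text \<open>
  This density statement solves the Dirichlet problem on a disc up to an arbitrarily small error, and by
  functions whose harmonic conjugate is explicit. It takes the place of the Poisson integral.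
\<close>
lemma Re_poly_dense_on_circle:
  fixes u :: "complex \<Rightarrow> real"
  assumes "continuous_on (sphere 0 R) u" "e > 0"
  obtains p where "\<And>z. norm z = R \<Longrightarrow> \<bar>u z - Re (poly p z)\<bar> < e"
proof -
  define P where "P = (\<lambda>g::complex\<Rightarrow>real. \<exists>p. \<forall>z. norm z = R \<longrightarrow> g z = Re (poly p z))"
  have "\<exists>g. P g \<and> (\<forall>x \<in> sphere 0 R. \<bar>u x - g x\<bar> < e)"
  proof (rule Stone_Weierstrass_HOL)
    show "P (\<lambda>_. c)" for c
      unfolding P_def by (intro exI[of _ "[:of_real c:]"]) simp
    show "continuous_on (sphere 0 R) g" if "P g" for g
    proof -
      from that obtain p where p: "\<And>z. norm z = R \<Longrightarrow> g z = Re (poly p z)" by (auto simp: P_def)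
      have "continuous_on (sphere 0 R) (\<lambda>z. Re (poly p z))" by (intro continuous_intros)
      thus ?thesis by (rule continuous_on_eq) (auto simp: p)
    qed
    show "P (\<lambda>x. g x + h x)" if gh: "P g \<and> P h" for g h
    proof -
      from gh obtain p q where "\<And>z. norm z = R \<Longrightarrow> g z = Re (poly p z)" "\<And>z. norm z = R \<Longrightarrow> h z = Re (poly q z)"
        by (auto simp: P_def)
      thus ?thesis unfolding P_def by (intro exI[of _ "p + q"]) auto
    qed
    show "P (\<lambda>x. g x * h x)" if gh: "P g \<and> P h" for g h
    proof -
      from gh obtain p q where pq: "\<And>z. norm z = R \<Longrightarrow> g z = Re (poly p z)" "\<And>z. norm z = R \<Longrightarrow> h z = Re (poly q z)"
        by (auto simp: P_def)
      obtain r where r: "\<And>z. norm z = R \<Longrightarrow> Re (poly p z * cnj (poly q z)) = Re (poly r z)"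
        using Re_poly_times_cnj_on_circle by blast
      show ?thesis unfolding P_def
      proof (intro exI[of _ "smult (1/2) (p * q + r)"] allI impI)
        fix z :: complex assume z: "norm z = R"
        \<comment> \<open>\<open>2 Re x Re y = Re (x y) + Re (x cnj y)\<close>\<close>
        show "g z * h z = Re (poly (smult (1/2) (p * q + r)) z)"
          using r[OF z, symmetric] by (simp add: pq[OF z])
      qed
    qed
    show "\<exists>f. P f \<and> f x \<noteq> f y" if "x \<in> sphere 0 R \<and> y \<in> sphere 0 R \<and> x \<noteq> y" for x y
    proof (cases "Re x = Re y")
      case False
      have "P Re" unfolding P_def by (intro exI[of _ "[:0,1:]"]) simp
      with False show ?thesis by blast
    next
      case True
      have "P Im" unfolding P_def by (intro exI[of _ "[:0,-\<i>:]"]) simp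
      moreover have "Im x \<noteq> Im y" using True that by (auto simp: complex_eq_iff)
      ultimately show ?thesis by blast
    qed
  qed (use assms in auto)
  then obtain g where g: "P g" "\<And>z. z \<in> sphere 0 R \<Longrightarrow> \<bar>u z - g z\<bar> < e"
    by blast
  from g(1) obtain p where p: "\<And>z. norm z = R \<Longrightarrow> g z = Re (poly p z)"
    unfolding P_def by blast
  show ?thesis
  proof (rule that[of p])
    show "\<bar>u z - Re (poly p z)\<bar> < e" if "norm z = R" for z
      using g(2)[of z] p[OF that] that by simp
  qed
qed

text \<open>
  The map \<open>w \<mapsto> w / (2A - w)\<close> sends the half plane \<open>Re w < A\<close> into the unit disc and fixes the origin, so
  the Schwarz lemma applies to its composition with \<open>h\<close>.
\<close>
lemma Borel_Caratheodory:
  assumes h: "h holomorphic_on ball 0 R" and "h 0 = 0" and "R > 0"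
    and A: "\<And>z. norm z < R \<Longrightarrow> Re (h z) < A"
    and z: "norm z \<le> R / 2"
  shows "norm (h z) \<le> 2 * A"
proof -
  have "A > 0" using A[of 0] assms by simp
  define k where "k = (\<lambda>z. h (of_real R * z))"
  have k: "k holomorphic_on ball 0 1"
    unfolding k_def
    by (rule holomorphic_on_compose_gen[OF _ h, unfolded o_def])
       (use \<open>R > 0\<close> in \<open>auto intro!: holomorphic_intros simp: norm_mult\<close>)
  have lt: "norm (k x) < norm (of_real (2 * A) - k x)" if "norm x < 1" for x
  proof -
    have "Re (k x) < A" unfolding k_def using that \<open>R > 0\<close> by (intro A) (auto simp: norm_mult)
    hence "A * Re (k x) < A * A" using \<open>A > 0\<close> by simp
    hence "(norm (k x))\<^sup>2 < (norm (of_real (2 * A) - k x))\<^sup>2"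
      unfolding cmod_power2 by (simp add: power2_eq_square algebra_simps)
    thus ?thesis by (rule power2_less_imp_less) simp
  qed
  have nz: "of_real (2 * A) - k x \<noteq> 0" if "norm x < 1" for x
    using lt[OF that] by force
  define x where "x = z / of_real R"
  have x: "norm x \<le> 1 / 2" using z \<open>R > 0\<close> by (simp add: x_def norm_divide field_simps)
  have "norm (k x / (of_real (2 * A) - k x)) \<le> norm x"
  proof (rule Schwarz_Lemma(1))
    show "(\<lambda>x. k x / (of_real (2 * A) - k x)) holomorphic_on ball 0 1"
      using nz by (intro holomorphic_intros k) auto
    show "k 0 / (of_real (2 * A) - k 0) = 0" using assms by (simp add: k_def)
    show "norm (k x / (of_real (2 * A) - k x)) < 1" if "norm x < 1" for x
      using lt[OF that] nz[OF that] by (simp add: norm_divide divide_simps)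
  qed (use x in auto)
  hence "norm (k x / (of_real (2 * A) - k x)) \<le> 1 / 2" using x by linarith
  hence "norm (k x) \<le> 1 / 2 * norm (of_real (2 * A) - k x)"
    using nz[of x] x by (simp add: norm_divide divide_simps)
  also have "norm (of_real (2 * A) - k x) \<le> 2 * A + norm (k x)"
    using norm_triangle_ineq4[of "of_real (2 * A)" "k x"] \<open>A > 0\<close> by (simp add: norm_mult)
  finally have "norm (k x) \<le> 2 * A" by simp
  moreover have "k x = h z" using \<open>R > 0\<close> by (simp add: k_def x_def)
  ultimately show ?thesis by simp
qed

text \<open>
  Both estimates replace \<open>u\<close> by the real part of a polynomial \<open>p\<close> lying slightly above it on the circle.
  The maximum principle for \<open>f exp (-p)\<close> carries \<open>\<bar>f\<bar> \<le> exp (Re p)\<close> inside the disc, and at the centre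
  \<open>Re p\<close> is its own mean. If \<open>u\<close> is non-negative, then so is \<open>Re p\<close> in the disc, and Harnack's inequality
  (here in the guise of Borel--Caratheodory) costs the factor \<open>3\<close> on the disc of half the radius.
  With \<open>u = log \<bar>f\<bar>\<close> on a zero-free circle the first estimate is the subharmonicity of \<open>log \<bar>f\<bar>\<close>; with \<open>u = log\<^sup>+ \<bar>f\<bar>\<close> the second
  one bounds the maximum modulus by the Nevanlinna characteristic.
\<close>
lemma
  fixes u :: "complex \<Rightarrow> real"
  assumes u: "continuous_on (sphere 0 R) u" and f: "f holomorphic_on UNIV" and "R > 0"
    and le: "\<And>z. norm z = R \<Longrightarrow> norm (f z) \<le> exp (u z)"
  shows norm_centre_le_exp_circle_mean: "norm (f 0) \<le> exp (circle_mean R u)"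
    and norm_le_exp_circle_mean:
      "(\<And>z. norm z = R \<Longrightarrow> u z \<ge> 0) \<Longrightarrow> norm z \<le> R / 2 \<Longrightarrow> norm (f z) \<le> exp (3 * circle_mean R u)"
proof -
  have *: "\<exists>p. (\<forall>z. norm z = R \<longrightarrow> u z \<le> Re (poly p z)) \<and>
            (\<forall>z. norm z \<le> R \<longrightarrow> norm (f z) \<le> exp (Re (poly p z))) \<and> Re (poly p 0) \<le> circle_mean R u + 2 * e"
    if "e > 0" for e
  proof -
    have "continuous_on (sphere 0 R) (\<lambda>z. u z + e)" by (intro continuous_intros u)
    from Re_poly_dense_on_circle[OF this \<open>e > 0\<close>]
    obtain p where p: "\<And>z. norm z = R \<Longrightarrow> \<bar>u z + e - Re (poly p z)\<bar> < e"
      by blast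
    have p1: "u z \<le> Re (poly p z)" and p2: "Re (poly p z) \<le> u z + 2 * e" if "norm z = R" for z
      using p[OF that] by linarith+
    have "norm (f z * exp (- poly p z)) \<le> 1" if "norm z \<le> R" for z
    proof (rule maximum_modulus_frontier[where f = "\<lambda>z. f z * exp (- poly p z)" and S = "cball 0 R"])
      show "(\<lambda>z. f z * exp (- poly p z)) holomorphic_on interior (cball 0 R)"
        by (intro holomorphic_intros holomorphic_on_subset[OF f]) auto
      show "continuous_on (closure (cball 0 R)) (\<lambda>z. f z * exp (- poly p z))"
        by (intro continuous_intros holomorphic_on_imp_continuous_on holomorphic_on_subset[OF f]) auto
      fix z :: complex assume "z \<in> frontier (cball 0 R)"
      hence z: "norm z = R" using \<open>R > 0\<close> by simp
      have "norm (f z) \<le> exp (Re (poly p z))" using le[OF z] p1[OF z] by (meson exp_le_cancel_iff order_trans)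
      thus "norm (f z * exp (- poly p z)) \<le> 1" by (simp add: norm_mult norm_divide exp_minus divide_simps)
    qed (use that in auto)
    hence "norm (f z) \<le> exp (Re (poly p z))" if "norm z \<le> R" for z
      using that by (simp add: norm_mult norm_divide exp_minus divide_simps)
    moreover have "Re (poly p 0) \<le> circle_mean R (\<lambda>z. u z + 2 * e)"
      unfolding circle_mean_Re_poly[OF less_imp_le[OF \<open>R > 0\<close>], symmetric]
      by (rule circle_mean_mono) (use \<open>R > 0\<close> p2 in \<open>auto intro!: continuous_intros u\<close>)
    moreover have "circle_mean R (\<lambda>z. u z + 2 * e) = circle_mean R u + 2 * e"
      by (subst circle_mean_add) (use u \<open>R > 0\<close> in auto)
    ultimately show ?thesis using p1 by (intro exI[of _ p]) auto
  qed
  show "norm (f 0) \<le> exp (circle_mean R u)"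
  proof (cases "f 0 = 0")
    case False
    have "ln (norm (f 0)) \<le> circle_mean R u"
    proof (rule field_le_epsilon)
      fix e :: real assume "e > 0"
      then obtain p where p: "norm (f 0) \<le> exp (Re (poly p 0))" "Re (poly p 0) \<le> circle_mean R u + 2 * (e/2)"
        using *[of "e/2"] \<open>R > 0\<close> by force
      have "ln (norm (f 0)) \<le> Re (poly p 0)"
        using p(1) False by (metis ln_exp ln_le_cancel_iff exp_gt_zero zero_less_norm_iff)
      thus "ln (norm (f 0)) \<le> circle_mean R u + e" using p(2) by simp
    qed
    thus ?thesis using False by (metis exp_le_cancel_iff exp_ln zero_less_norm_iff)
  qed auto
  assume pos: "\<And>z. norm z = R \<Longrightarrow> u z \<ge> 0" and z: "norm z \<le> R / 2"
  show "norm (f z) \<le> exp (3 * circle_mean R u)"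
  proof (cases "f z = 0")
    case False
    have "ln (norm (f z)) \<le> 3 * circle_mean R u"
    proof (rule field_le_epsilon)
      fix e :: real assume "e > 0"
      \<comment> \<open>The errors add up to \<open>3 (e / 4) + 2 (e / 8) = e\<close>.\<close>
      then obtain p where p: "\<And>z. norm z = R \<Longrightarrow> u z \<le> Re (poly p z)" 
        "\<And>z. norm z \<le> R \<Longrightarrow> norm (f z) \<le> exp (Re (poly p z))" "Re (poly p 0) \<le> circle_mean R u + 2 * (e/8)"
        using *[of "e/8"] by auto
      have p0: "Re (- poly p x) \<le> 0" if "norm x \<le> R" for x
      proof (rule maximum_real_frontier[where f = "\<lambda>x. - poly p x" and S = "cball 0 R"])
        show "(\<lambda>x. - poly p x) holomorphic_on interior (cball 0 R)" by (intro holomorphic_intros)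
        show "continuous_on (closure (cball 0 R)) (\<lambda>x. - poly p x)" by (intro continuous_intros)
        fix z :: complex assume "z \<in> frontier (cball 0 R)"
        thus "Re (- poly p z) \<le> 0" using p(1)[of z] pos[of z] \<open>R > 0\<close> by auto
      qed (use that in auto)
      have "norm (poly p 0 - poly p z) \<le> 2 * (Re (poly p 0) + e / 8)"
      proof (rule Borel_Caratheodory[where h = "\<lambda>z. poly p 0 - poly p z" and R = R])
        show "(\<lambda>z. poly p 0 - poly p z) holomorphic_on ball 0 R" by (intro holomorphic_intros)
        show "Re (poly p 0 - poly p x) < Re (poly p 0) + e / 8" if "norm x < R" for x
          using p0[of x] that \<open>e > 0\<close> by simp
      qed (use z \<open>R > 0\<close> in auto)
      moreover have "Re (poly p z) - Re (poly p 0) \<le> norm (poly p 0 - poly p z)"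
        using abs_Re_le_cmod[of "poly p 0 - poly p z"] by simp
      moreover have "ln (norm (f z)) \<le> Re (poly p z)"
        using p(2)[of z] z \<open>R > 0\<close> False by (metis ln_exp ln_le_cancel_iff exp_gt_zero zero_less_norm_iff field_sum_of_halves add_increasing2 half_gt_zero less_imp_le)
      ultimately show "ln (norm (f z)) \<le> 3 * circle_mean R u + e" using p(3) \<open>e > 0\<close> by argo
    qed
    thus ?thesis using False by (metis exp_le_cancel_iff exp_ln zero_less_norm_iff)
  qed auto
qed

section \<open>Entire functions of bounded growth\<close>

text \<open>
  Entire functions of order at most \<open>s\<close> and finite type for that order. The weight \<open>1 + \<bar>z\<bar>\<close> avoids a
  separate regime near the origin and behaves well under translations.
\<close>
definition growth_le :: "real \<Rightarrow> (complex \<Rightarrow> complex) \<Rightarrow> bool" where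
  "growth_le s f \<longleftrightarrow> f holomorphic_on UNIV \<and> (\<exists>C. \<forall>z. norm (f z) \<le> exp (C * (1 + norm z) powr s))"

lemma growth_le_holomorphic: "growth_le s f \<Longrightarrow> f holomorphic_on A"
  using holomorphic_on_subset by (auto simp: growth_le_def)

lemma growth_leE:
  assumes "growth_le s f"
  obtains C where "C \<ge> 0" "\<And>z. norm (f z) \<le> exp (C * (1 + norm z) powr s)"
proof -
  from assms obtain C where C: "\<And>z. norm (f z) \<le> exp (C * (1 + norm z) powr s)"
    by (auto simp: growth_le_def)
  show ?thesis
  proof (rule that[of "max 0 C"])
    fix z :: complex
    have "C * (1 + norm z) powr s \<le> max 0 C * (1 + norm z) powr s" by (intro mult_right_mono) auto
    thus "norm (f z) \<le> exp (max 0 C * (1 + norm z) powr s)" using C[of z] by (meson exp_le_cancel_iff order_trans)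
  qed auto
qed

lemma growth_leI:
  assumes "f holomorphic_on UNIV" "\<And>z. norm (f z) \<le> exp (C * (1 + norm z) powr s)"
  shows "growth_le s f"
  using assms by (auto simp: growth_le_def)

lemma one_le_powr_norm: "s \<ge> 0 \<Longrightarrow> 1 \<le> (1 + norm z) powr s"
  by (intro ge_one_powr_ge_zero) auto

lemma growth_le_mono:
  assumes "growth_le s f" "s \<le> t"
  shows "growth_le t f"
proof -
  obtain C where C: "C \<ge> 0" "\<And>z. norm (f z) \<le> exp (C * (1 + norm z) powr s)"
    using growth_leE[OF assms(1)] by blast
  show ?thesis
  proof (rule growth_leI)
    fix z :: complex
    have "C * (1 + norm z) powr s \<le> C * (1 + norm z) powr t"
      by (intro mult_left_mono powr_mono) (use assms C in auto)
    thus "norm (f z) \<le> exp (C * (1 + norm z) powr t)" using C(2)[of z] by (meson exp_le_cancel_iff order_trans)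
  qed (rule growth_le_holomorphic[OF assms(1)])
qed

lemma growth_le_mult:
  assumes "growth_le s f" "growth_le s g"
  shows "growth_le s (\<lambda>z. f z * g z)"
proof -
  obtain C D where C: "\<And>z. norm (f z) \<le> exp (C * (1 + norm z) powr s)"
    and D: "\<And>z. norm (g z) \<le> exp (D * (1 + norm z) powr s)"
    using growth_leE[OF assms(1)] growth_leE[OF assms(2)] by metis
  show ?thesis
  proof (rule growth_leI)
    show "norm (f z * g z) \<le> exp ((C + D) * (1 + norm z) powr s)" for z
      using mult_mono[OF C[of z] D[of z]] by (simp add: norm_mult distrib_right exp_add)
  qed (intro holomorphic_intros growth_le_holomorphic[OF assms(1)] growth_le_holomorphic[OF assms(2)])
qed

lemma growth_le_add:
  assumes "growth_le s f" "growth_le s g" "s \<ge> 0"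
  shows "growth_le s (\<lambda>z. f z + g z)"
proof -
  obtain C D where C: "C \<ge> 0" "\<And>z. norm (f z) \<le> exp (C * (1 + norm z) powr s)"
    and D: "D \<ge> 0" "\<And>z. norm (g z) \<le> exp (D * (1 + norm z) powr s)"
    using growth_leE[OF assms(1)] growth_leE[OF assms(2)] by metis
  show ?thesis
  proof (rule growth_leI)
    fix z :: complex
    let ?t = "(1 + norm z) powr s"
    have t: "?t \<ge> 1" using assms by (intro one_le_powr_norm)
    have "norm (f z + g z) \<le> norm (f z) + norm (g z)" by (rule norm_triangle_ineq)
    also have "norm (f z) \<le> exp ((C + D) * ?t)"
      by (rule order_trans[OF C(2)]) (use D(1) in \<open>auto intro!: mult_right_mono\<close>)
    also have "norm (g z) \<le> exp ((C + D) * ?t)"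
      by (rule order_trans[OF D(2)]) (use C(1) in \<open>auto intro!: mult_right_mono\<close>)
    also have "exp ((C + D) * ?t) + exp ((C + D) * ?t) = 2 * exp ((C + D) * ?t)" by simp
    also have "2 \<le> exp ?t" using exp_ge_add_one_self[of ?t] t by linarith
    finally show "norm (f z + g z) \<le> exp ((C + D + 1) * ?t)" by (simp add: distrib_right exp_add mult.commute)
  qed (intro holomorphic_intros growth_le_holomorphic[OF assms(1)] growth_le_holomorphic[OF assms(2)])
qed

lemma growth_le_const [simp]:
  assumes "s \<ge> 0" shows "growth_le s (\<lambda>_. c)"
proof (rule growth_leI)
  fix z :: complex
  have "norm c * 1 \<le> norm c * (1 + norm z) powr s" using assms by (intro mult_left_mono one_le_powr_norm) auto
  thus "norm c \<le> exp (norm c * (1 + norm z) powr s)" using exp_ge_add_one_self[of "norm c * (1 + norm z) powr s"] by linarith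
qed auto

lemma growth_le_uminus: "growth_le s f \<Longrightarrow> growth_le s (\<lambda>z. - f z)"
  by (auto simp: growth_le_def intro: holomorphic_intros)

lemma growth_le_diff: "growth_le s f \<Longrightarrow> growth_le s g \<Longrightarrow> s \<ge> 0 \<Longrightarrow> growth_le s (\<lambda>z. f z - g z)"
  using growth_le_add[OF _ growth_le_uminus, of s f g] by simp

lemma growth_le_power: "growth_le s f \<Longrightarrow> s \<ge> 0 \<Longrightarrow> growth_le s (\<lambda>z. f z ^ n)"
  by (induction n) (auto intro: growth_le_mult)

lemma growth_le_prod: "s \<ge> 0 \<Longrightarrow> (\<And>i. i \<in> I \<Longrightarrow> growth_le s (f i)) \<Longrightarrow> growth_le s (\<lambda>z. \<Prod>i\<in>I. f i z)"
  by (induction I rule: infinite_finite_induct) (auto intro: growth_le_mult)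

lemma growth_le_ident [simp]:
  assumes "s > 0" shows "growth_le s (\<lambda>z. z)"
proof (rule growth_leI)
  fix z :: complex
  have "ln (1 + norm z) \<le> (1 + norm z) powr s / s" by (rule ln_powr_bound) (use assms in auto)
  hence "exp (ln (1 + norm z)) \<le> exp (1 / s * (1 + norm z) powr s)" by simp
  moreover have "exp (ln (1 + norm z)) = 1 + norm z" by (intro exp_ln add_pos_nonneg) auto
  ultimately have "1 + norm z \<le> exp (1 / s * (1 + norm z) powr s)" by simp
  thus "norm z \<le> exp (1 / s * (1 + norm z) powr s)" by linarith
qed auto

lemma growth_le_poly [simp]:
  assumes "s > 0" shows "growth_le s (poly p)"
proof (induction p)
  case 0
  have "poly 0 = (\<lambda>_. 0 :: complex)" by (rule ext) simp
  moreover have "growth_le s (\<lambda>_. 0)" using assms by (intro growth_le_const) auto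
  ultimately show ?case by simp
next
  case (pCons a p)
  have "poly (pCons a p) = (\<lambda>z. a + z * poly p z)" by (rule ext) simp
  moreover have "growth_le s (\<lambda>z. a + z * poly p z)"
    by (intro growth_le_add growth_le_mult pCons growth_le_ident growth_le_const) (use assms in auto)
  ultimately show ?case by simp
qed

lemma growth_le_shift:
  assumes "growth_le s f" "s \<ge> 0"
  shows "growth_le s (\<lambda>z. f (z + c))"
proof -
  obtain C where C: "C \<ge> 0" "\<And>z. norm (f z) \<le> exp (C * (1 + norm z) powr s)"
    using growth_leE[OF assms(1)] by blast
  show ?thesis
  proof (rule growth_leI)
    fix z :: complex
    have "1 + norm (z + c) \<le> 1 + norm z + norm c" using norm_triangle_ineq[of z c] by simp
    also have "\<dots> \<le> (1 + norm c) * (1 + norm z)" by (simp add: algebra_simps)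
    finally have "C * (1 + norm (z + c)) powr s \<le> C * ((1 + norm c) * (1 + norm z)) powr s"
      by (intro mult_left_mono powr_mono2) (use assms C in auto)
    also have "\<dots> = C * (1 + norm c) powr s * (1 + norm z) powr s" by (subst powr_mult) auto
    finally show "norm (f (z + c)) \<le> exp (C * (1 + norm c) powr s * (1 + norm z) powr s)"
      using C(2)[of "z + c"] by (meson exp_le_cancel_iff order_trans)
  qed (use growth_le_holomorphic[OF assms(1)] in \<open>auto intro!: holomorphic_on_compose_gen[of "\<lambda>z. z + c" _ f UNIV, unfolded o_def] holomorphic_intros\<close>)
qed

lemma growth_le_deriv:
  assumes "growth_le s f" "s \<ge> 0"
  shows "growth_le s (deriv f)"
proof -
  obtain C where C: "C \<ge> 0" "\<And>z. norm (f z) \<le> exp (C * (1 + norm z) powr s)"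
    using growth_leE[OF assms(1)] by blast
  show ?thesis
  proof (rule growth_leI)
    fix z :: complex
    have "norm ((deriv ^^ 1) f z) \<le> fact 1 * exp (C * 2 powr s * (1 + norm z) powr s) / 1 ^ 1"
    proof (rule Cauchy_inequality)
      fix x assume x: "norm (z - x) = 1"
      have "norm x \<le> norm z + norm (z - x)" using norm_triangle_ineq4[of z "z - x"] by simp
      hence "1 + norm x \<le> 2 * (1 + norm z)" using x norm_ge_zero[of z] by argo
      hence "C * (1 + norm x) powr s \<le> C * (2 * (1 + norm z)) powr s"
        by (intro mult_left_mono powr_mono2) (use assms C in auto)
      also have "\<dots> = C * 2 powr s * (1 + norm z) powr s" by (subst powr_mult) auto
      finally show "norm (f x) \<le> exp (C * 2 powr s * (1 + norm z) powr s)"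
        using C(2)[of x] by (meson exp_le_cancel_iff order_trans)
    qed (auto intro: growth_le_holomorphic[OF assms(1)] holomorphic_on_imp_continuous_on)
    thus "norm (deriv f z) \<le> exp (C * 2 powr s * (1 + norm z) powr s)" by simp
  qed (auto intro!: holomorphic_deriv growth_le_holomorphic[OF assms(1)])
qed

lemma growth_le_exp_poly:
  fixes s :: real
  assumes "degree p \<le> s"
  shows "growth_le s (\<lambda>z. exp (poly p z))"
proof (rule growth_leI)
  fix z :: complex
  define t where "t = 1 + norm z"
  have t: "t \<ge> 1" by (simp add: t_def)
  have "norm (poly p z) \<le> (\<Sum>i\<le>degree p. norm (coeff p i) * norm z ^ i)"
    unfolding poly_altdef by (rule order_trans[OF norm_sum]) (simp add: norm_mult norm_power)
  also have "\<dots> \<le> (\<Sum>i\<le>degree p. norm (coeff p i) * t powr s)"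
  proof (intro sum_mono mult_left_mono)
    fix i assume i: "i \<in> {..degree p}"
    have "norm z ^ i \<le> t ^ i" by (intro power_mono) (auto simp: t_def)
    also have "\<dots> = t powr real i" using t by (simp add: powr_realpow)
    also have "\<dots> \<le> t powr s" using i assms t by (intro powr_mono) auto
    finally show "norm z ^ i \<le> t powr s" .
  qed auto
  also have "\<dots> = (\<Sum>i\<le>degree p. norm (coeff p i)) * t powr s" by (simp add: sum_distrib_right)
  finally have "Re (poly p z) \<le> (\<Sum>i\<le>degree p. norm (coeff p i)) * t powr s"
    using complex_Re_le_cmod order_trans by blast
  thus "norm (exp (poly p z)) \<le> exp ((\<Sum>i\<le>degree p. norm (coeff p i)) * (1 + norm z) powr s)"
    by (simp add: t_def)
qed (intro holomorphic_intros)

text \<open>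
  A sharpened Liouville theorem: a one-sided bound on the real part is turned into a bound on the modulus
  by Borel--Caratheodory, after which the Cauchy estimates annihilate every Taylor coefficient of index
  larger than \<open>s\<close>.
\<close>
lemma entire_Re_bound_imp_poly:
  fixes s :: real
  assumes g: "g holomorphic_on UNIV" and "s \<ge> 0"
    and le: "\<And>z. Re (g z) \<le> C * (1 + norm z) powr s"
  obtains p where "g = poly p" "degree p \<le> s"
proof -
  define D where "D = max C 0"
  \<comment> \<open>Borel--Caratheodory on the disc of radius \<open>2 r\<close>, where \<open>1 + \<bar>z\<bar> \<le> 3 r\<close> because \<open>r \<ge> 1\<close>.\<close>
  define M where "M = 2 * (D * 3 powr s + norm (g 0) + 1) + norm (g 0)"
  have bound: "norm (g z) \<le> M * r powr s" if z: "norm z \<le> r" and "r \<ge> 1" for z r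
  proof -
    have r1: "r powr s \<ge> 1" using \<open>r \<ge> 1\<close> assms by (intro ge_one_powr_ge_zero) auto
    have "norm (g z - g 0) \<le> 2 * (D * (3 * r) powr s + norm (g 0) + 1)"
    proof (rule Borel_Caratheodory[where h = "\<lambda>z. g z - g 0" and R = "2 * r"])
      show "(\<lambda>z. g z - g 0) holomorphic_on ball 0 (2 * r)"
        by (intro holomorphic_intros holomorphic_on_subset[OF g]) auto
      fix x :: complex assume x: "norm x < 2 * r"
      have "Re (g x) \<le> C * (1 + norm x) powr s" by (rule le)
      also have "\<dots> \<le> D * (3 * r) powr s"
        by (intro mult_mono powr_mono2) (use x \<open>r \<ge> 1\<close> assms in \<open>auto simp: D_def\<close>)
      finally show "Re (g x - g 0) < D * (3 * r) powr s + norm (g 0) + 1"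
        using abs_Re_le_cmod[of "g 0"] by simp
    qed (use z \<open>r \<ge> 1\<close> in auto)
    moreover have "norm (g z) \<le> norm (g z - g 0) + norm (g 0)" by (metis diff_add_cancel norm_triangle_ineq)
    ultimately have "norm (g z) \<le> 2 * D * 3 powr s * r powr s + (3 * norm (g 0) + 2) * 1"
      using \<open>r \<ge> 1\<close> by (simp add: powr_mult)
    also have "\<dots> \<le> 2 * D * 3 powr s * r powr s + (3 * norm (g 0) + 2) * r powr s"
      by (intro add_left_mono mult_left_mono r1) auto
    finally show ?thesis by (simp add: M_def algebra_simps)
  qed
  have M: "M \<ge> 0" by (simp add: M_def D_def)
  define n where "n = nat \<lceil>s\<rceil>"
  define a where "a = (\<lambda>k. (deriv ^^ k) g 0 / fact k)"
  have g_eq: "g z = (\<Sum>k\<le>n. a k * z ^ k)" for z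
    unfolding a_def
  proof (rule Liouville_polynomial[OF g])
    fix z :: complex assume z: "1 \<le> norm z"
    have "norm (g z) \<le> M * norm z powr s" using bound[of z "norm z"] z by simp
    also have "norm z powr s \<le> norm z powr real n"
      using z unfolding n_def by (intro powr_mono real_nat_ceiling_ge) auto
    also have "norm z powr real n = norm z ^ n" using z by (subst powr_realpow) auto
    finally show "norm (g z) \<le> M * norm z ^ n" using M by (simp add: mult_left_mono)
  qed
  have a0: "a k = 0" if "real k > s" for k
  proof -
    have "norm ((deriv ^^ k) g 0) \<le> fact k * M * r powr (s - k)" if "r \<ge> 1" for r
    proof -
      have "norm ((deriv ^^ k) g 0) \<le> fact k * (M * r powr s) / r ^ k"
        by (rule Cauchy_inequality)
           (use that bound in \<open>auto intro!: holomorphic_on_subset[OF g] holomorphic_on_imp_continuous_on\<close>)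
      also have "\<dots> = fact k * M * r powr (s - k)"
        using that by (simp add: powr_diff[of r s "real k"] powr_realpow)
      finally show ?thesis .
    qed
    hence "eventually (\<lambda>r. norm ((deriv ^^ k) g 0) \<le> fact k * M * r powr (s - k)) at_top"
      using eventually_ge_at_top[of 1] by (rule eventually_mono[rotated]) auto
    moreover have "((\<lambda>r. fact k * M * r powr (s - k)) \<longlongrightarrow> fact k * M * 0) at_top"
      by (intro tendsto_intros tendsto_neg_powr filterlim_ident) (use \<open>real k > s\<close> in auto)
    ultimately have "norm ((deriv ^^ k) g 0) \<le> fact k * M * 0"
      by (intro tendsto_lowerbound) auto
    thus ?thesis by (simp add: a_def)
  qed
  define p where "p = (\<Sum>k\<le>n. monom (a k) k)"
  have "degree p \<le> nat \<lfloor>s\<rfloor>"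
  proof (rule degree_le, intro allI impI)
    fix i assume "nat \<lfloor>s\<rfloor> < i"
    hence "real i > s" using assms by linarith
    thus "coeff p i = 0" using a0 by (auto simp: p_def coeff_sum)
  qed
  hence "real (degree p) \<le> s" using assms by linarith
  moreover have "g = poly p"
    by (rule ext) (simp add: g_eq p_def poly_sum poly_monom)
  ultimately show ?thesis using that by blast
qed

lemma exp_poly_growth_le_imp_degree_le:
  fixes s :: real
  assumes "growth_le s (\<lambda>z. exp (poly p z))" "s \<ge> 0"
  shows "degree p \<le> s"
proof -
  obtain C where "\<And>z. norm (exp (poly p z)) \<le> exp (C * (1 + norm z) powr s)"
    using growth_leE[OF assms(1)] by metis
  hence "Re (poly p z) \<le> C * (1 + norm z) powr s" for z by simp
  moreover have "poly p holomorphic_on UNIV" by (intro holomorphic_intros)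
  ultimately obtain q where "poly p = poly q" "degree q \<le> s"
    using entire_Re_bound_imp_poly[of "poly p" s C] assms(2) by blast
  thus ?thesis by (metis poly_eq_poly_eq_iff)
qed

section \<open>Exact division and Borel's theorem\<close>

lemma log_plus_nonneg: "log_plus x \<ge> 0"
  by (simp add: log_plus_def)

lemma log_plus_eq: "x \<ge> 0 \<Longrightarrow> log_plus x = ln (max 1 x)"
  by (cases "x = 0"; cases "x \<le> 1") (auto simp: log_plus_def max_def)

lemma le_exp_log_plus: "x \<ge> 0 \<Longrightarrow> x \<le> exp (log_plus x)"
  by (simp add: log_plus_eq)

lemma log_plus_le: "x \<ge> 0 \<Longrightarrow> x \<le> exp B \<Longrightarrow> B \<ge> 0 \<Longrightarrow> log_plus x \<le> B"
  using ln_mono[of "max 1 x" "exp B"] by (simp add: log_plus_eq)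

lemma ln_le_log_plus: "ln x \<le> log_plus x"
  by (simp add: log_plus_def)

lemma continuous_on_log_plus_norm [continuous_intros]:
  assumes "continuous_on S f"
  shows "continuous_on S (\<lambda>z. log_plus (norm (f z)))"
proof -
  have "continuous_on S (\<lambda>z. ln (max 1 (norm (f z))))"
    by (intro continuous_intros assms) auto
  thus ?thesis by (simp add: log_plus_eq)
qed

text \<open>
  The zeros in a compact disc have only finitely many absolute values. The freedom in choosing the radius
  keeps \<open>log \<bar>G\<bar>\<close> continuous on the circles used below.
\<close>
lemma entire_zero_free_circle:
  assumes "G holomorphic_on UNIV" "G z0 \<noteq> 0" "a < b"
  obtains R where "a < R" "R < b" "\<And>z. norm z = R \<Longrightarrow> G z \<noteq> 0"
proof -
  have "\<exists>R\<in>{a<..<b}. \<forall>z. norm z = R \<longrightarrow> G z \<noteq> 0"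
  proof (cases "G constant_on UNIV")
    case True
    hence "G z \<noteq> 0" for z using assms(2) by (metis UNIV_I constant_on_def)
    thus ?thesis using \<open>a < b\<close> by (intro bexI[of _ "(a + b) / 2"]) auto
  next
    case False
    have "finite {z \<in> cball 0 b. G z = 0}"
      by (rule holomorphic_compact_finite_zeros[OF assms(1)]) (use False in auto)
    hence "finite (norm ` {z \<in> cball 0 b. G z = 0})" by simp
    moreover have "infinite {a<..<b}" using \<open>a < b\<close> by simp
    ultimately obtain R where "R \<in> {a<..<b}" "R \<notin> norm ` {z \<in> cball 0 b. G z = 0}"
      by (meson finite_subset subsetI)
    thus ?thesis by (intro bexI[of _ R]) auto
  qed
  thus ?thesis using that by auto
qed

text \<open>
  The heart of the growth estimates: dividing by \<open>G\<close> is as harmless as multiplying by it, although \<open>1 / G\<close>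
  may be huge near the zeros of \<open>G\<close>. On a zero-free circle \<open>log\<^sup>+ \<bar>1/G\<bar> = log\<^sup>+ \<bar>G\<bar> - log \<bar>G\<bar>\<close>, and the
  mean of \<open>log \<bar>G\<bar>\<close> is at least \<open>log \<bar>G 0\<bar>\<close>. Hence \<open>log \<bar>E\<bar>\<close> is dominated on the circle by a
  non-negative function of controlled mean.
\<close>
lemma entire_quotient_bound:
  assumes hol: "E holomorphic_on UNIV" "G holomorphic_on UNIV" "K holomorphic_on UNIV"
    and EG: "\<And>z. E z * G z = K z" and "G 0 \<noteq> 0" "r > 0" "B \<ge> 0"
    and GB: "\<And>z. norm z \<le> 4 * r \<Longrightarrow> norm (G z) \<le> exp B"
    and KB: "\<And>z. norm z \<le> 4 * r \<Longrightarrow> norm (K z) \<le> exp B"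
    and z: "norm z \<le> r"
  shows "norm (E z) \<le> exp (3 * (2 * B - ln (norm (G 0))))"
proof -
  obtain R where R: "2 * r < R" "R < 4 * r" and nz: "\<And>z. norm z = R \<Longrightarrow> G z \<noteq> 0"
    using entire_zero_free_circle[OF hol(2) \<open>G 0 \<noteq> 0\<close>, of "2 * r" "4 * r"] \<open>r > 0\<close> by auto
  have "R > 0" using R \<open>r > 0\<close> by linarith
  note cont = holomorphic_on_imp_continuous_on[OF holomorphic_on_subset[OF hol(2)], of "sphere 0 R"]
    holomorphic_on_imp_continuous_on[OF holomorphic_on_subset[OF hol(3)], of "sphere 0 R"]
  define u v where "u = (\<lambda>z. log_plus (norm (K z)) + log_plus (norm (G z)))" and "v = (\<lambda>z. ln (norm (G z)))"
  have u: "continuous_on (sphere 0 R) u" unfolding u_def by (intro continuous_intros cont) auto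
  have v: "continuous_on (sphere 0 R) v" unfolding v_def by (intro continuous_intros cont) (use nz in auto)
  have "norm (G 0) \<le> exp (circle_mean R v)"
    by (rule norm_centre_le_exp_circle_mean[OF v hol(2) \<open>R > 0\<close>]) (use nz in \<open>auto simp: v_def\<close>)
  hence mv: "ln (norm (G 0)) \<le> circle_mean R v"
    using \<open>G 0 \<noteq> 0\<close> by (metis ln_exp ln_le_cancel_iff exp_gt_zero zero_less_norm_iff)
  have "circle_mean R u \<le> circle_mean R (\<lambda>_. B + B)"
    unfolding u_def
    by (rule circle_mean_mono[OF u[unfolded u_def] _ _ add_mono[OF log_plus_le log_plus_le]])
       (use R \<open>R > 0\<close> \<open>B \<ge> 0\<close> in \<open>auto intro!: GB KB\<close>)
  hence mu: "circle_mean R u \<le> 2 * B" by simp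
  have "norm (E z) \<le> exp (3 * circle_mean R (\<lambda>z. u z - v z))"
  proof (rule norm_le_exp_circle_mean[OF _ hol(1) \<open>R > 0\<close>])
    show "continuous_on (sphere 0 R) (\<lambda>z. u z - v z)" by (intro continuous_intros u v)
    fix x :: complex assume x: "norm x = R"
    show "0 \<le> u x - v x"
      using log_plus_nonneg[of "norm (K x)"] ln_le_log_plus[of "norm (G x)"] by (simp add: u_def v_def)
    have "norm (K x) \<le> exp (u x)"
      by (rule order_trans[OF le_exp_log_plus]) (use log_plus_nonneg in \<open>auto simp: u_def\<close>)
    thus "norm (E x) \<le> exp (u x - v x)"
      using nz[OF x] by (simp add: EG[symmetric] norm_mult exp_diff v_def field_simps)
  qed (use z R in auto)
  also have "circle_mean R (\<lambda>z. u z - v z) = circle_mean R u - circle_mean R v"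
    using \<open>R > 0\<close> by (intro circle_mean_diff u v) auto
  also have "exp (3 * \<dots>) \<le> exp (3 * (2 * B - ln (norm (G 0))))" using mu mv by simp
  finally show ?thesis .
qed

text \<open>
  The class of entire functions of growth at most \<open>s\<close> is closed under exact division. A translation moves
  the origin to a point where the divisor does not vanish.
\<close>
lemma growth_le_quotient:
  assumes G: "growth_le s G" and K: "growth_le s K" and E: "E holomorphic_on UNIV" and "s \<ge> 0"
    and EG: "\<And>z. E z * G z = K z" and z0: "G z0 \<noteq> 0"
  shows "growth_le s E"
proof -
  have *: "growth_le s E" if G: "growth_le s G" and K: "growth_le s K" and E: "E holomorphic_on UNIV"
    and EG: "\<And>z. E z * G z = K z" and G0: "G 0 \<noteq> 0" for E G K :: "complex \<Rightarrow> complex"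
  proof -
    obtain C D where C: "C \<ge> 0" "\<And>z. norm (G z) \<le> exp (C * (1 + norm z) powr s)"
      and D: "D \<ge> 0" "\<And>z. norm (K z) \<le> exp (D * (1 + norm z) powr s)"
      using growth_leE[OF G] growth_leE[OF K] by metis
    define M where "M = \<bar>ln (norm (G 0))\<bar>"
    show ?thesis
    proof (rule growth_leI[OF E])
      fix z :: complex
      define t where "t = 1 + norm z"
      have t: "t \<ge> 1" by (simp add: t_def)
      have t': "t powr s \<ge> 1" unfolding t_def by (intro one_le_powr_norm assms)
      define B where "B = (C + D) * (5 * t) powr s"
      have "norm (E z) \<le> exp (3 * (2 * B - ln (norm (G 0))))"
      proof (rule entire_quotient_bound[OF E _ _ EG G0])
        fix x :: complex assume x: "norm x \<le> 4 * t"
        have "C * (1 + norm x) powr s \<le> (C + D) * (5 * t) powr s"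
             "D * (1 + norm x) powr s \<le> (C + D) * (5 * t) powr s"
          by (intro mult_mono powr_mono2; use C D t x assms in simp)+
        thus "norm (G x) \<le> exp B" "norm (K x) \<le> exp B"
          using C(2)[of x] D(2)[of x] unfolding B_def by (meson exp_le_cancel_iff order_trans)+
      next
        show "t > 0" using t by simp
      qed (use C D in \<open>auto simp: B_def t_def intro: growth_le_holomorphic[OF G] growth_le_holomorphic[OF K]\<close>)
      also have "3 * (2 * B - ln (norm (G 0))) \<le> 6 * B + 3 * M" by (simp add: M_def)
      also have "\<dots> \<le> 6 * B + 3 * (M * t powr s)" using mult_left_mono[OF t', of M] by (simp add: M_def)
      also have "\<dots> = (6 * (C + D) * 5 powr s + 3 * M) * t powr s"
        using t by (simp add: B_def powr_mult algebra_simps)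
      finally show "norm (E z) \<le> exp ((6 * (C + D) * 5 powr s + 3 * M) * (1 + norm z) powr s)"
        by (simp add: t_def)
    qed
  qed
  have hol: "(\<lambda>z. E (z + z0)) holomorphic_on UNIV"
    by (rule holomorphic_on_compose_gen[of "\<lambda>z. z + z0" _ E UNIV, unfolded o_def]) (auto intro!: holomorphic_intros E)
  have "growth_le s (\<lambda>z. E (z + z0))"
    by (rule *[OF growth_le_shift[OF G] growth_le_shift[OF K] hol]) (use EG z0 \<open>s \<ge> 0\<close> in auto)
  from growth_le_shift[OF this \<open>s \<ge> 0\<close>, of "-z0"] show ?thesis by simp
qed

text \<open>
  Division by \<open>G\<close> shows that \<open>exp g\<close> itself has growth at most \<open>s\<close>, which limits the degree of \<open>g\<close>.
\<close>
lemma exp_poly_mult_growth_le_imp_degree_le: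
  fixes s :: real
  assumes "growth_le s G" "growth_le s K" "s \<ge> 0" "G a \<noteq> 0"
    and "\<And>z. G z * exp (poly g z) = K z"
  shows "degree g \<le> s"
proof (rule exp_poly_growth_le_imp_degree_le[OF growth_le_quotient[OF assms(1,2) _ assms(3) _ assms(4)] assms(3)])
  show "(\<lambda>z. exp (poly g z)) holomorphic_on UNIV" by (intro holomorphic_intros)
  show "exp (poly g z) * G z = K z" for z using assms(5)[of z] by (simp add: mult.commute)
qed

lemma entire_identity:
  assumes "F holomorphic_on UNIV" "K holomorphic_on UNIV" "open U" "a \<in> U" "\<And>z. z \<in> U \<Longrightarrow> F z = K z"
  shows "F z = K z"
proof -
  have "F z - K z = 0"
  proof (rule analytic_continuation[where f = "\<lambda>z. F z - K z" and S = UNIV and U = U])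
    show "a islimpt U" using assms by (intro interior_limit_point) (auto simp: interior_open)
  qed (use assms in \<open>auto intro!: holomorphic_intros\<close>)
  thus ?thesis by simp
qed

lemma entire_nonzero_ball:
  assumes "G holomorphic_on UNIV" "G z0 \<noteq> 0"
  obtains e where "e > 0" "\<And>z. z \<in> ball z0 e \<Longrightarrow> G z \<noteq> 0"
proof -
  have "continuous (at z0) G"
    using holomorphic_on_imp_continuous_on[OF assms(1)] by (simp add: continuous_on_eq_continuous_at)
  thus ?thesis using continuous_at_avoid[of z0 G 0] assms(2) that by (auto simp: dist_commute)
qed

lemma entire_mult_eq_0:
  assumes "F holomorphic_on UNIV" "G holomorphic_on UNIV" "\<And>z. F z * G z = 0" "G a \<noteq> 0"
  shows "F z = 0"
proof -
  obtain e where e: "e > 0" "\<And>z. z \<in> ball a e \<Longrightarrow> G z \<noteq> 0"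
    using entire_nonzero_ball[OF assms(2,4)] by blast
  show ?thesis
  proof (rule entire_identity[where F = F and U = "ball a e" and a = a and K = "\<lambda>_. 0"])
    show "F x = 0" if "x \<in> ball a e" for x
      using assms(3)[of x] e(2)[OF that] by simp
  qed (use assms(1) \<open>e > 0\<close> in auto)
qed

text \<open>
  A vanishing Wronskian: \<open>F / K\<close> has derivative zero near a point where \<open>K\<close> does not vanish, and the
  resulting local proportionality extends to the plane by the identity theorem.
\<close>
lemma entire_proportional:
  assumes F: "F holomorphic_on UNIV" and K: "K holomorphic_on UNIV" and z0: "K z0 \<noteq> 0"
    and W: "\<And>z. deriv F z * K z = F z * deriv K z"
  obtains c where "\<And>z. F z = c * K z"
proof -
  obtain e where e: "e > 0" "\<And>z. z \<in> ball z0 e \<Longrightarrow> K z \<noteq> 0"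
    using entire_nonzero_ball[OF K z0] by blast
  have "\<exists>c. \<forall>z\<in>ball z0 e. F z / K z = c"
  proof (rule has_field_derivative_zero_constant)
    fix z assume z: "z \<in> ball z0 e"
    have "(F has_field_derivative deriv F z) (at z within ball z0 e)"
         "(K has_field_derivative deriv K z) (at z within ball z0 e)"
      using holomorphic_derivI[OF F open_UNIV UNIV_I] holomorphic_derivI[OF K open_UNIV UNIV_I]
        has_field_derivative_at_within by blast+
    from DERIV_divide[OF this e(2)[OF z]] W[of z]
    show "((\<lambda>z. F z / K z) has_field_derivative 0) (at z within ball z0 e)" by simp
  qed auto
  then obtain c where c: "\<And>z. z \<in> ball z0 e \<Longrightarrow> F z = c * K z"
    using e(2) by (metis nonzero_divide_eq_eq)
  have "F z = c * K z" for z
  proof (rule entire_identity[where F = F and U = "ball z0 e" and a = z0 and K = "\<lambda>z. c * K z"])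
    show "(\<lambda>z. c * K z) holomorphic_on UNIV" by (intro holomorphic_intros K)
  qed (use F c \<open>e > 0\<close> in auto)
  thus ?thesis using that by blast
qed

text \<open>
  A form of Borel's theorem in which only the exponent \<open>g j\<close> needs to be separated from the others; the
  remaining exponents may well coincide modulo terms of low degree. The proof removes one summand \<open>k \<noteq> j\<close>
  at a time by dividing by it and differentiating. The coefficients of the new relation are Wronskians
  \<open>W i\<close>, again of growth at most \<open>s\<close>. By induction \<open>W j\<close> vanishes, so the \<open>j\<close>-th and the \<open>k\<close>-th
  summand are proportional, which the difference in growth of their exponentials forbids unless \<open>G j = 0\<close>.
\<close>
lemma Borel_exponential_independence:
  fixes s :: real and g :: "'i \<Rightarrow> complex poly"
  assumes "finite I" "s > 0" "\<And>i. i \<in> I \<Longrightarrow> growth_le s (G i)"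
    and "\<And>z. (\<Sum>i\<in>I. G i z * exp (poly (g i) z)) = 0"
    and "j \<in> I" "\<And>i. i \<in> I \<Longrightarrow> i \<noteq> j \<Longrightarrow> degree (g i - g j) > s"
  shows "G j z = 0"
  using assms
proof (induction "card I" arbitrary: I G z rule: less_induct)
  case less
  note [simp] = \<open>finite I\<close>
  have hol [holomorphic_intros]: "G i holomorphic_on A" if "i \<in> I" for i A
    using less.prems(3)[OF that] growth_le_holomorphic by blast
  show ?case
  proof (cases "\<exists>k\<in>I - {j}. \<exists>z. G k z \<noteq> 0")
    case False
    have "(\<Sum>i\<in>I. G i z * exp (poly (g i) z)) = (\<Sum>i\<in>{j}. G i z * exp (poly (g i) z))"
      by (rule sum.mono_neutral_right) (use False less.prems in auto)
    thus ?thesis using less.prems(4)[of z] by simp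
  next
    case True
    then obtain k z0 where k: "k \<in> I" "k \<noteq> j" "G k z0 \<noteq> 0" by auto
    define F where "F = (\<lambda>i z. G i z * exp (poly (g i) z))"
    define F' where "F' = (\<lambda>i z. (deriv (G i) z + poly (pderiv (g i)) z * G i z) * exp (poly (g i) z))"
    define W where "W = (\<lambda>i z. (deriv (G i) z + poly (pderiv (g i)) z * G i z) * G k z
                              - G i z * (deriv (G k) z + poly (pderiv (g k)) z * G k z))"
    have F': "(F i has_field_derivative F' i z) (at z)" if "i \<in> I" for i z
      unfolding F_def F'_def
      by (auto intro!: derivative_eq_intros holomorphic_derivI[OF hol[OF that] open_UNIV UNIV_I] simp: algebra_simps)
    \<comment> \<open>Clearing denominators in the derivative of \<open>F i / F k\<close> and splitting off the exponentials.\<close>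
    have WF: "W i z * exp (poly (g i) z) * exp (poly (g k) z) = F' i z * F k z - F i z * F' k z" for i z
      by (simp add: W_def F_def F'_def algebra_simps)
    have W0: "(\<Sum>i\<in>I - {k}. W i z * exp (poly (g i) z)) = 0" for z
    proof -
      have "((\<lambda>z. \<Sum>i\<in>I. F i z) has_field_derivative (\<Sum>i\<in>I. F' i z)) (at z)"
        by (intro DERIV_sum F')
      moreover have "(\<lambda>z. \<Sum>i\<in>I. F i z) = (\<lambda>_. 0)" using less.prems(4) by (simp add: F_def)
      ultimately have "(\<Sum>i\<in>I. F' i z) = 0" using DERIV_unique[OF _ DERIV_const] by metis
      moreover have "(\<Sum>i\<in>I. F i z) = 0" using less.prems(4) by (simp add: F_def)
      ultimately have "0 = (\<Sum>i\<in>I. F' i z) * F k z - (\<Sum>i\<in>I. F i z) * F' k z" by simp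
      also have "\<dots> = (\<Sum>i\<in>I. W i z * exp (poly (g i) z)) * exp (poly (g k) z)"
        by (simp add: WF sum_distrib_right sum_subtractf)
      also have "(\<Sum>i\<in>I. W i z * exp (poly (g i) z)) = (\<Sum>i\<in>I - {k}. W i z * exp (poly (g i) z))"
        by (rule sum.mono_neutral_right) (auto simp: W_def)
      finally show ?thesis by simp
    qed
    have "W j z = 0" for z
    proof (rule less.hyps[of "I - {k}" W])
      show "card (I - {k}) < card I" using k by (intro psubset_card_mono) auto
      show "growth_le s (W i)" if "i \<in> I - {k}" for i
        unfolding W_def using that k(1) less.prems(2,3)
        by (intro growth_le_diff growth_le_mult growth_le_add growth_le_deriv growth_le_poly) auto
    qed (use W0 less.prems k in auto)
    hence "F' j z * F k z = F j z * F' k z" for z using WF[of j z] by simp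
    moreover have "deriv (F i) z = F' i z" if "i \<in> I" for i z using F'[OF that] by (rule DERIV_imp_deriv)
    ultimately have "deriv (F j) z * F k z = F j z * deriv (F k) z" for z using k less.prems(5) by simp
    then obtain c where c: "\<And>z. F j z = c * F k z"
    proof (rule entire_proportional[rotated 3])
      show "F j holomorphic_on UNIV" "F k holomorphic_on UNIV"
        unfolding F_def using k less.prems(5) by (auto intro!: holomorphic_intros)
      show "F k z0 \<noteq> 0" using k by (simp add: F_def)
    qed blast
    show ?thesis
    proof (rule ccontr)
      assume nz: "G j z \<noteq> 0"
      have "degree (g j - g k) \<le> s"
      proof (rule exp_poly_mult_growth_le_imp_degree_le)
        show "growth_le s (G j)" "growth_le s (\<lambda>z. c * G k z)"
          using less.prems k by (auto intro!: growth_le_mult)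
        show "G j z * exp (poly (g j - g k) z) = c * G k z" for z
          using c[of z] by (simp add: F_def exp_diff field_simps)
      qed (use nz less.prems in auto)
      moreover have "degree (g j - g k) = degree (g k - g j)" by (metis degree_minus minus_diff_eq)
      ultimately show False using less.prems(6)[of k] k by simp
    qed
  qed
qed

section \<open>Nevanlinna characteristic and growth\<close>

text \<open>
  An entire function has no poles, so its characteristic is its proximity function.
\<close>
lemma nevanlinna_char_entire:
  assumes "f holomorphic_on UNIV"
  shows "nevanlinna_char r f = circle_mean r (\<lambda>z. log_plus (norm (f z)))"
proof -
  have "\<not> is_pole f z" for z
    using assms not_is_pole_holomorphic[of UNIV z f] by auto
  hence "pole_count t f = 0" for t by (simp add: pole_count_def)
  thus ?thesis by (simp add: nevanlinna_char_def proximity_def integrated_pole_count_def circle_mean_def)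
qed

text \<open>
  The order is defined through circle means; the second majorant estimate, on a circle of at least twice the
  radius, turns them into pointwise bounds.
\<close>
lemma growth_order_less_imp_growth_le:
  assumes f: "f holomorphic_on UNIV" and less: "growth_order f < ereal s" and "s \<ge> 0"
  shows "growth_le s f"
proof -
  define T where "T = (\<lambda>r. nevanlinna_char r f)"
  have "eventually (\<lambda>r. ereal (log_plus (T r) / ln r) < ereal s) at_top"
    using less unfolding growth_order_def T_def by (rule Limsup_lessD)
  then obtain r0 where r0: "\<And>r. r \<ge> r0 \<Longrightarrow> log_plus (T r) / ln r < s"
    by (auto simp: eventually_at_top_linorder)
  define r1 where "r1 = max r0 2"
  have T: "T r \<le> r powr s" if "r \<ge> r1" for r
  proof (cases "T r > 0")
    case True
    have "r > 1" "ln r > 0" using that by (auto simp: r1_def)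
    hence "log_plus (T r) < s * ln r" using r0[of r] that by (simp add: r1_def field_simps)
    hence "ln (T r) \<le> s * ln r" using ln_le_log_plus[of "T r"] by linarith
    hence "exp (ln (T r)) \<le> exp (s * ln r)" by simp
    thus ?thesis using True \<open>r > 1\<close> by (simp add: powr_def)
  qed (auto intro: order_trans[of _ 0])
  have cont: "continuous_on (sphere 0 R) (\<lambda>z. log_plus (norm (f z)))" for R
    by (intro continuous_intros holomorphic_on_imp_continuous_on holomorphic_on_subset[OF f]) auto
  show ?thesis
  proof (rule growth_leI[OF f])
    fix z :: complex
    define R where "R = 2 * r1 * (1 + norm z)"
    have "r1 \<ge> 2" by (simp add: r1_def)
    have "r1 * 1 \<le> r1 * (1 + norm z)" "1 * norm z \<le> r1 * norm z"
      using \<open>r1 \<ge> 2\<close> by (intro mult_left_mono mult_right_mono; simp)+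
    hence R: "R \<ge> r1" "norm z \<le> R / 2" using \<open>r1 \<ge> 2\<close> by (auto simp: R_def algebra_simps)
    have "R > 0" using R(1) \<open>r1 \<ge> 2\<close> by linarith
    have "norm (f z) \<le> exp (3 * circle_mean R (\<lambda>z. log_plus (norm (f z))))"
      by (rule norm_le_exp_circle_mean[OF cont f \<open>R > 0\<close> le_exp_log_plus log_plus_nonneg R(2)]) auto
    also have "circle_mean R (\<lambda>z. log_plus (norm (f z))) = T R"
      by (simp add: T_def nevanlinna_char_entire[OF f])
    also have "exp (3 * T R) \<le> exp (3 * R powr s)" using T[OF R(1)] by simp
    also have "R powr s = (2 * r1) powr s * (1 + norm z) powr s"
      using \<open>r1 \<ge> 2\<close> by (simp add: R_def powr_mult)
    finally show "norm (f z) \<le> exp (3 * (2 * r1) powr s * (1 + norm z) powr s)" by (simp add: mult_ac)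
  qed
qed

lemma growth_le_imp_growth_order_le:
  assumes "growth_le s f" "s \<ge> 0"
  shows "growth_order f \<le> ereal s"
proof -
  obtain C where C: "C \<ge> 0" "\<And>z. norm (f z) \<le> exp (C * (1 + norm z) powr s)"
    using growth_leE[OF assms(1)] by blast
  have f: "f holomorphic_on UNIV" by (rule growth_le_holomorphic[OF assms(1)])
  have le: "log_plus (nevanlinna_char r f) / ln r \<le> (ln (C + 1) + s * ln (1 + r)) / ln r" if "r > 1" for r
  proof -
    have cont: "continuous_on (sphere 0 r) (\<lambda>z. log_plus (norm (f z)))"
      by (intro continuous_intros holomorphic_on_imp_continuous_on holomorphic_on_subset[OF f]) auto
    have "nevanlinna_char r f \<le> circle_mean r (\<lambda>_. C * (1 + r) powr s)"
      unfolding nevanlinna_char_entire[OF f]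
      by (rule circle_mean_mono[OF cont _ _ log_plus_le]) (use that C(1) in \<open>auto intro: C(2)\<close>)
    also have "\<dots> \<le> (C + 1) * (1 + r) powr s" by (simp add: mult_right_mono)
    finally have "nevanlinna_char r f \<le> (C + 1) * (1 + r) powr s" .
    moreover have "circle_mean r (\<lambda>_. 0) \<le> nevanlinna_char r f"
      unfolding nevanlinna_char_entire[OF f]
      by (rule circle_mean_mono[OF _ cont]) (use that log_plus_nonneg in auto)
    moreover have "(C + 1) * (1 + r) powr s = exp (ln (C + 1) + s * ln (1 + r))"
      using C(1) that by (simp add: exp_add powr_def)
    ultimately have "log_plus (nevanlinna_char r f) \<le> ln (C + 1) + s * ln (1 + r)"
      using C(1) that assms(2) by (intro log_plus_le) auto
    thus ?thesis using that by (intro divide_right_mono) auto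
  qed
  have "growth_order f \<le> Limsup at_top (\<lambda>r. ereal ((ln (C + 1) + s * ln (1 + r)) / ln r))"
    unfolding growth_order_def
    by (rule Limsup_mono, rule eventually_mono[OF eventually_gt_at_top[of "1::real"]]) (use le in simp)
  also have "((\<lambda>r. (ln (C + 1) + s * ln (1 + r)) / ln r) \<longlongrightarrow> s) at_top"
    by real_asymp
  hence "((\<lambda>r. ereal ((ln (C + 1) + s * ln (1 + r)) / ln r)) \<longlongrightarrow> ereal s) at_top"
    by (intro tendsto_intros)
  hence "Limsup at_top (\<lambda>r. ereal ((ln (C + 1) + s * ln (1 + r)) / ln r)) = ereal s"
    by (intro lim_imp_Limsup) auto
  finally show ?thesis .
qed

lemma zero_exponent_nonneg: "zero_exponent f \<ge> 0"
  unfolding zero_exponent_def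
proof (rule le_Limsup)
  show "\<forall>\<^sub>F r in at_top. 0 \<le> ereal (log_plus (real (pole_count r (\<lambda>z. 1 / f z))) / ln r)"
    using eventually_gt_at_top[of "1::real"] by eventually_elim (simp add: log_plus_nonneg)
qed auto

lemma zero_exponent_less_imp_count_le:
  assumes "zero_exponent f < ereal s"
  obtains r0 where "r0 \<ge> 1" "\<And>r. r \<ge> r0 \<Longrightarrow> real (pole_count r (\<lambda>z. 1 / f z)) \<le> r powr s"
proof -
  define N where "N = (\<lambda>r. real (pole_count r (\<lambda>z. 1 / f z)))"
  have "eventually (\<lambda>r. ereal (log_plus (N r) / ln r) < ereal s) at_top"
    using assms unfolding zero_exponent_def N_def by (rule Limsup_lessD)
  then obtain r0 where r0: "\<And>r. r \<ge> r0 \<Longrightarrow> log_plus (N r) / ln r < s"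
    by (auto simp: eventually_at_top_linorder)
  have N: "N r \<le> r powr s" if "r \<ge> max r0 2" for r
  proof (cases "N r > 0")
    case True
    have "r > 1" "ln r > 0" using that by auto
    hence "log_plus (N r) < s * ln r" using r0[of r] that by (simp add: field_simps)
    hence "ln (N r) \<le> s * ln r" using ln_le_log_plus[of "N r"] by linarith
    hence "exp (ln (N r)) \<le> exp (s * ln r)" by simp
    thus ?thesis using True \<open>r > 1\<close> by (simp add: powr_def)
  qed (auto intro: order_trans[of _ 0])
  show ?thesis by (rule that[of "max r0 2"]) (use N in \<open>auto simp: N_def\<close>)
qed

lemma pole_count_reciprocal:
  assumes f: "f holomorphic_on UNIV" and "f z0 \<noteq> 0"
  shows "pole_count r (\<lambda>z. 1 / f z) = (\<Sum>z | norm z \<le> r \<and> f z = 0. nat (zorder f z))"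
proof -
  have ev: "eventually (\<lambda>w. f w \<noteq> 0) (at z)" for z
    using non_zero_neighbour_alt[OF f open_UNIV connected_UNIV UNIV_I UNIV_I assms(2), of z] by simp
  have cont: "isCont f z" for z
    using holomorphic_on_imp_continuous_on[OF f] by (simp add: continuous_on_eq_continuous_at)
  have an: "f analytic_on {z}" for z using f by (auto simp: analytic_at)
  have pole: "is_pole (\<lambda>z. 1 / f z) z \<longleftrightarrow> f z = 0" for z
  proof -
    have "is_pole (\<lambda>z. 1 / f z) z \<longleftrightarrow> isolated_zero f z"
      using is_pole_inverse_iff[of f z] by (simp add: inverse_eq_divide)
    also have "\<dots> \<longleftrightarrow> f z = 0"
      using zero_isolated_zero[OF _ cont[of z]] cont[of z] ev[of z]
      by (auto simp: isolated_zero_def isCont_def)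
    finally show ?thesis .
  qed
  have "zorder (\<lambda>z. 1 / f z) z = - zorder f z" for z
    using zorder_inverse[of f z] ev[of z] an[of z] eventually_frequently[of "at z"]
    by (simp add: inverse_eq_divide isolated_singularity_at_analytic not_essential_analytic)
  thus ?thesis by (simp add: pole_count_def pole)
qed

section \<open>Canonical products and Hadamard's factorization\<close>

text \<open>
  Near the origin the factor is \<open>1 + O(u\<^bsup>p+1\<^esup>)\<close>, which is enough because \<open>s \<le> p + 1\<close>; away from the
  origin its logarithm is at most \<open>log (1 + \<bar>u\<bar>)\<close> plus a polynomial of degree \<open>p \<le> s\<close> in \<open>\<bar>u\<bar>\<close>.
\<close>
lemma weierstrass_factor_growth:
  fixes s :: real
  assumes "real p \<le> s" "s \<le> real (Suc p)" "s > 0"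
  obtains C where "C \<ge> 0" "\<And>u. norm (weierstrass_factor p u) \<le> exp (C * norm u powr s)"
proof -
  \<comment> \<open>\<open>3\<close> serves \<open>\<bar>u\<bar> \<le> 1/2\<close>; the other terms bound \<open>1 - u\<close> and the exponential for \<open>\<bar>u\<bar> > 1/2\<close>.\<close>
  define C where "C = 3 + 4 powr s / s + real p * 2 powr s"
  have C: "C \<ge> 3" "C \<ge> 4 powr s / s + real p * 2 powr s" using \<open>s > 0\<close> by (simp_all add: C_def)
  have "norm (weierstrass_factor p u) \<le> exp (C * norm u powr s)" for u
  proof (cases "norm u \<le> 1 / 2")
    case True
    have "norm (weierstrass_factor p u) \<le> 1 + norm (weierstrass_factor p u - 1)"
      by (metis add.commute diff_add_cancel norm_one norm_triangle_ineq)
    also have "\<dots> \<le> 1 + 3 * norm u ^ Suc p" using weierstrass_factor_bound[OF True, of p] by simp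
    also have "norm u ^ Suc p \<le> norm u powr s"
    proof (cases "u = 0")
      case False
      hence "norm u ^ Suc p = norm u powr real (Suc p)" by (subst powr_realpow) auto
      also have "\<dots> \<le> norm u powr s" by (rule powr_mono') (use assms True in auto)
      finally show ?thesis .
    qed auto
    also have "1 + 3 * norm u powr s \<le> exp (3 * norm u powr s)" by (rule exp_ge_add_one_self)
    also have "\<dots> \<le> exp (C * norm u powr s)" using C by (simp add: mult_right_mono)
    finally show ?thesis by simp
  next
    case False
    define x where "x = norm u"
    have x: "x > 1 / 2" using False by (simp add: x_def)
    have "ln (1 + x) \<le> (1 + x) powr s / s" by (rule ln_powr_bound) (use x assms in auto)
    also have "\<dots> \<le> (4 * x) powr s / s" by (intro divide_right_mono powr_mono2) (use x assms in auto)
    also have "\<dots> = 4 powr s / s * x powr s" using x by (simp add: powr_mult)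
    finally have "exp (ln (1 + x)) \<le> exp (4 powr s / s * x powr s)" by simp
    moreover have "norm (1 - u) \<le> 1 + x" using norm_triangle_ineq4[of 1 u] by (simp add: x_def)
    ultimately have 1: "norm (1 - u) \<le> exp (4 powr s / s * x powr s)" using x by simp
    have "Re (\<Sum>k=1..p. u ^ k / of_nat k) \<le> norm (\<Sum>k=1..p. u ^ k / of_nat k)" by (rule complex_Re_le_cmod)
    also have "\<dots> \<le> (\<Sum>k=1..p. x ^ k / real k)"
      by (rule order_trans[OF norm_sum]) (simp add: norm_divide norm_power x_def)
    also have "\<dots> \<le> (\<Sum>k=1..p. (2 * x) powr s)"
    proof (rule sum_mono)
      fix k assume k: "k \<in> {1..p}"
      have "x ^ k / real k \<le> x ^ k" using k x by (simp add: field_simps mult_le_cancel_left1)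
      also have "\<dots> \<le> (2 * x) ^ k" using x by (intro power_mono) auto
      also have "\<dots> = (2 * x) powr real k" using x by (subst powr_realpow) auto
      also have "\<dots> \<le> (2 * x) powr s" by (rule powr_mono) (use k x assms in auto)
      finally show "x ^ k / real k \<le> (2 * x) powr s" .
    qed
    also have "\<dots> = real p * 2 powr s * x powr s" using x by (simp add: powr_mult)
    finally have 2: "norm (exp (\<Sum>k=1..p. u ^ k / of_nat k)) \<le> exp (real p * 2 powr s * x powr s)" by simp
    have "norm (weierstrass_factor p u) \<le> exp (4 powr s / s * x powr s) * exp (real p * 2 powr s * x powr s)"
      unfolding weierstrass_factor_def norm_mult by (rule mult_mono[OF 1 2]) auto
    also have "\<dots> = exp ((4 powr s / s + real p * 2 powr s) * x powr s)" by (simp add: distrib_right exp_add)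
    also have "\<dots> \<le> exp (C * x powr s)" using C by (simp add: mult_right_mono)
    finally show ?thesis by (simp add: x_def)
  qed
  thus ?thesis using that[of C] C by simp
qed

text \<open>
  With the constant genus \<open>\<lfloor>s\<rfloor>\<close> the bounds on the individual factors multiply to
  \<open>exp (C \<bar>z\<bar>\<^sup>s \<Sum> \<bar>a n\<bar>\<^bsup>-s\<^esup>)\<close>.
\<close>
lemma canonical_product_growth:
  fixes a :: "nat \<Rightarrow> complex" and s :: real
  assumes a: "\<And>n. a n \<noteq> 0" and lim: "filterlim a at_infinity at_top"
    and summ: "summable (\<lambda>n. norm (a n) powr - s)" and "s > 0"
  defines "p \<equiv> nat \<lfloor>s\<rfloor>"
  shows "weierstrass_product a (\<lambda>_. p)"
    and "growth_le s (weierstrass_product.f a (\<lambda>_. p))"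
proof -
  have p: "real p \<le> s" "s \<le> real (Suc p)" using \<open>s > 0\<close> unfolding p_def by linarith+
  show wp: "weierstrass_product a (\<lambda>_. p)"
  proof
    fix r :: real assume "r > 0"
    show "summable (\<lambda>n. (r / norm (a n)) ^ Suc p)"
    proof (rule summable_comparison_test_ev)
      have "eventually (\<lambda>n. norm (a n) > r) at_top"
        using lim by (metis filterlim_at_infinity_imp_norm_at_top filterlim_at_top_dense)
      thus "eventually (\<lambda>n. norm ((r / norm (a n)) ^ Suc p) \<le> r powr s * norm (a n) powr - s) at_top"
      proof eventually_elim
        case (elim n)
        have "(r / norm (a n)) ^ Suc p = (r / norm (a n)) powr real (Suc p)"
          using \<open>r > 0\<close> a[of n] by (subst powr_realpow) auto
        also have "\<dots> \<le> (r / norm (a n)) powr s"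
          by (rule powr_mono') (use p elim \<open>r > 0\<close> a[of n] in \<open>auto simp: field_simps\<close>)
        also have "\<dots> = r powr s * norm (a n) powr - s"
          using \<open>r > 0\<close> by (simp add: powr_divide powr_minus divide_simps)
        finally show ?case using \<open>r > 0\<close> by simp
      qed
      show "summable (\<lambda>n. r powr s * norm (a n) powr - s)" by (intro summable_mult summ)
    qed
  qed (use a lim in auto)
  interpret weierstrass_product a "\<lambda>_. p" by (rule wp)
  obtain C where C: "C \<ge> 0" "\<And>u. norm (weierstrass_factor p u) \<le> exp (C * norm u powr s)"
    using weierstrass_factor_growth[OF p \<open>s > 0\<close>] by blast
  define S where "S = (\<Sum>n. norm (a n) powr - s)"
  show "growth_le s f"
  proof (rule growth_leI)
    fix z :: complex
    have "(\<lambda>n. norm (\<Prod>k\<le>n. weierstrass_factor p (z / a k))) \<longlonglongrightarrow> norm (f z)"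
      by (intro tendsto_norm has_prod_imp_tendsto has_prod)
    moreover have "norm (\<Prod>k\<le>n. weierstrass_factor p (z / a k)) \<le> exp (C * S * (1 + norm z) powr s)" for n
    proof -
      have "norm (\<Prod>k\<le>n. weierstrass_factor p (z / a k)) \<le> (\<Prod>k\<le>n. exp (C * norm (z / a k) powr s))"
        unfolding prod_norm[symmetric] by (intro prod_mono) (use C(2) in auto)
      also have "\<dots> = exp (\<Sum>k\<le>n. C * norm (z / a k) powr s)" by (simp add: exp_sum)
      also have "(\<Sum>k\<le>n. C * norm (z / a k) powr s) = C * norm z powr s * (\<Sum>k\<le>n. norm (a k) powr - s)"
        by (simp add: sum_distrib_left norm_divide powr_divide powr_minus_divide mult_ac)
      also have "\<dots> \<le> C * (1 + norm z) powr s * S"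
        unfolding S_def using C(1) \<open>s > 0\<close>
        by (intro mult_mono mult_left_mono powr_mono2 sum_le_suminf summ sum_nonneg) auto
      finally show ?thesis by (simp add: mult_ac)
    qed
    ultimately show "norm (f z) \<le> exp (C * S * (1 + norm z) powr s)"
      by (intro LIMSEQ_le_const2) auto
  qed (rule holomorphic)
qed

text \<open>
  If the zeros are listed by increasing modulus and with multiplicity, then the counting bound says
  \<open>n + 1 \<le> \<bar>a n\<bar>\<^sup>l\<close> for all large \<open>n\<close>. Hence \<open>\<bar>a n\<bar>\<^bsup>-s\<^esup>\<close> is dominated by \<open>(n + 1)\<^bsup>-s/l\<^esup>\<close>, which is
  summable, and the canonical product of genus \<open>\<lfloor>s\<rfloor>\<close> has growth at most \<open>s\<close>. A zero at the origin is
  supplied by a power of \<open>z\<close>. If there are only finitely many zeros, a polynomial does.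
\<close>
lemma entire_with_same_zeros_growth_le:
  fixes f :: "complex \<Rightarrow> complex" and l s :: real
  assumes f: "f holomorphic_on UNIV" "f z0 \<noteq> 0" and "0 < l" "l < s" and "r0 \<ge> 1"
    and count: "\<And>r. r \<ge> r0 \<Longrightarrow> real (pole_count r (\<lambda>z. 1 / f z)) \<le> r powr l"
  obtains H where "growth_le s H" "\<And>z. H z = 0 \<longleftrightarrow> f z = 0" "\<And>z. zorder H z = zorder f z"
proof -
  define Z where "Z = {z. f z = 0}"
  define c where "c = (\<lambda>z. nat (zorder f z))"
  have "s > 0" using assms by simp
  have an: "f analytic_on {z}" for z using f(1) by (auto simp: analytic_at)
  have ev: "eventually (\<lambda>w. f w \<noteq> 0) (at z)" for z
    using non_zero_neighbour_alt[OF f(1) open_UNIV connected_UNIV UNIV_I UNIV_I f(2), of z] by simp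
  hence freq: "frequently (\<lambda>w. f w \<noteq> 0) (at z)" for z using eventually_frequently[of "at z"] by simp
  have ord_pos: "zorder f z > 0 \<longleftrightarrow> z \<in> Z" for z
    using zorder_pos_iff[OF f(1) open_UNIV UNIV_I freq] by (simp add: Z_def)
  have ord_nonneg: "zorder f z \<ge> 0" for z by (rule zorder_ge_0[OF an freq])
  have fin: "finite (Z \<inter> cball 0 r)" for r
  proof (cases "f constant_on UNIV")
    case True
    hence "Z = {}" using f(2) by (auto simp: Z_def constant_on_def)
    thus ?thesis by simp
  next
    case False
    have "finite {z \<in> cball 0 r. f z = 0}"
      by (rule holomorphic_compact_finite_zeros[OF f(1)]) (use False in auto)
    moreover have "{z \<in> cball 0 r. f z = 0} = Z \<inter> cball 0 r" by (auto simp: Z_def)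
    ultimately show ?thesis by simp
  qed
  have ord0: "zorder f z = 0" if "z \<notin> Z" for z
    using that by (intro zorder_eq_0I an) (auto simp: Z_def)
  show ?thesis
  proof (cases "finite Z")
    case True
    define H where "H = (\<lambda>z. \<Prod>w\<in>Z. (z - w) ^ c w)"
    show ?thesis
    proof (rule that[of H])
      show "growth_le s H" unfolding H_def using \<open>s > 0\<close>
        by (intro growth_le_prod growth_le_power growth_le_diff growth_le_ident growth_le_const) auto
      show H0: "H z = 0 \<longleftrightarrow> f z = 0" for z
        using True ord_pos by (auto simp: H_def c_def Z_def)
      fix z
      show "zorder H z = zorder f z"
      proof (cases "z \<in> Z")
        case False
        have "H analytic_on {z}" unfolding H_def by (intro analytic_intros)
        hence "zorder H z = 0" using False H0 by (intro zorder_eq_0I) (auto simp: Z_def)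
        thus ?thesis using ord0[OF False] by simp
      next
        case z: True
        show ?thesis
        proof (rule zorder_eqI)
          show "(\<lambda>x. \<Prod>w\<in>Z - {z}. (x - w) ^ c w) holomorphic_on UNIV" by (intro holomorphic_intros)
          fix x
          show "H x = (\<Prod>w\<in>Z - {z}. (x - w) ^ c w) * (x - z) powi zorder f z"
            unfolding H_def prod.remove[OF True z] using ord_nonneg[of z] by (simp add: c_def power_int_def)
        qed (use True in auto)
      qed
    qed
  next
    case False
    have no_limpt: "\<not> z islimpt Z" for z
      using ev[of z] by (auto simp: islimpt_iff_eventually Z_def elim!: eventually_mono)
    obtain a where a: "incseq (norm \<circ> a)" "range a = Z - {0}" "filterlim a at_infinity at_top"
        "\<And>z. z \<in> Z - {0} \<Longrightarrow> finite (a -` {z}) \<and> card (a -` {z}) = c z"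
    proof (rule sequence_of_sparse_set_exists'[of "Z - {0}" c])
      show "infinite (Z - {0})" using False by simp
      show "closed (Z - {0})" unfolding closed_limpt using no_limpt islimpt_subset by blast
      show "finite ((Z - {0}) \<inter> cball 0 r)" for r by (rule finite_subset[OF _ fin[of r]]) auto
      show "c z > 0" if "z \<in> Z - {0}" for z using that ord_pos[of z] by (simp add: c_def)
    qed metis
    have a_nz: "a n \<noteq> 0" for n using a(2) by auto
    have card_le: "real (Suc n) \<le> norm (a n) powr l" if "norm (a n) \<ge> r0" for n
    proof -
      let ?A = "(Z - {0}) \<inter> cball 0 (norm (a n))"
      have finA: "finite ?A" by (rule finite_subset[OF _ fin[of "norm (a n)"]]) auto
      have "{..n} \<subseteq> (\<Union>z\<in>?A. a -` {z})"
        using a(2) monoD[OF a(1)] by (auto 4 4)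
      hence "card {..n} \<le> card (\<Union>z\<in>?A. a -` {z})"
        using a(4) finA by (intro card_mono) auto
      also have "\<dots> \<le> (\<Sum>z\<in>?A. card (a -` {z}))" by (rule card_UN_le[OF finA])
      also have "\<dots> = (\<Sum>z\<in>?A. c z)" by (intro sum.cong) (use a(4) in auto)
      also have "\<dots> \<le> (\<Sum>z | norm z \<le> norm (a n) \<and> f z = 0. c z)"
      proof (rule sum_mono2)
        show "finite {z. norm z \<le> norm (a n) \<and> f z = 0}"
          by (rule finite_subset[OF _ fin[of "norm (a n)"]]) (auto simp: Z_def)
      qed (auto simp: Z_def)
      also have "\<dots> = pole_count (norm (a n)) (\<lambda>z. 1 / f z)"
        by (simp add: pole_count_reciprocal[OF f] c_def)
      finally have "real (Suc n) \<le> real (pole_count (norm (a n)) (\<lambda>z. 1 / f z))" by simp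
      also have "\<dots> \<le> norm (a n) powr l" by (rule count[OF that])
      finally show ?thesis .
    qed
    have summ: "summable (\<lambda>n. norm (a n) powr - s)"
    proof (rule summable_comparison_test_ev)
      have "eventually (\<lambda>n. norm (a n) \<ge> r0) at_top"
        using a(3) by (metis filterlim_at_infinity_imp_norm_at_top filterlim_at_top)
      thus "eventually (\<lambda>n. norm (norm (a n) powr - s) \<le> real (Suc n) powr - (s / l)) at_top"
      proof eventually_elim
        case (elim n)
        have "norm (a n) powr - s = (norm (a n) powr l) powr - (s / l)"
          using \<open>0 < l\<close> by (simp add: powr_powr)
        also have "\<dots> \<le> real (Suc n) powr - (s / l)"
          by (rule powr_mono2') (use card_le[OF elim] assms in auto)
        finally show ?case by simp
      qed
      have "summable (\<lambda>n. real n powr - (s / l))" using assms by (simp add: summable_real_powr_iff)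
      thus "summable (\<lambda>n. real (Suc n) powr - (s / l))" by (subst summable_Suc_iff)
    qed
    note prod = canonical_product_growth[OF a_nz a(3) summ \<open>s > 0\<close>]
    interpret W: weierstrass_product a "\<lambda>_. nat \<lfloor>s\<rfloor>" by (rule prod(1))
    define m where "m = c 0"
    define H where "H = (\<lambda>z. z ^ m * W.f z)"
    show ?thesis
    proof (rule that[of H])
      show "growth_le s H" unfolding H_def using \<open>s > 0\<close>
        by (intro growth_le_mult growth_le_power growth_le_ident prod(2)) auto
      show H0: "H z = 0 \<longleftrightarrow> f z = 0" for z
        using ord_pos[of 0] by (auto simp: H_def W.zero a(2) Z_def m_def c_def)
      fix z
      consider "z = 0" | "z \<noteq> 0" "z \<in> Z" | "z \<notin> Z" by blast
      thus "zorder H z = zorder f z"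
      proof cases
        case 1
        show ?thesis
        proof (rule zorder_eqI)
          show "W.f holomorphic_on UNIV" by (rule W.holomorphic)
          show "W.f z \<noteq> 0" using 1 a(2) by (simp add: W.zero)
          show "H x = W.f x * (x - z) powi zorder f z" for x
            using 1 ord_nonneg[of 0] by (simp add: H_def m_def c_def power_int_def)
        qed auto
      next
        case 2
        have "eventually (\<lambda>w. w ^ m * W.f w \<noteq> 0) (at z)"
          using ev[of z] H0 by (simp add: H_def)
        hence "zorder H z = zorder (\<lambda>z. z ^ m) z + zorder W.f z"
          unfolding H_def by (intro zorder_times_analytic) (auto intro!: analytic_intros W.analytic)
        moreover have "zorder (\<lambda>z. z ^ m) z = 0"
          using 2 by (intro zorder_eq_0I) (auto intro!: analytic_intros)
        moreover have "zorder W.f z = int (c z)" using 2 a(4)[of z] by (simp add: W.zorder)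
        ultimately show ?thesis using ord_nonneg[of z] by (simp add: c_def)
      next
        case 3
        have "H analytic_on {z}" unfolding H_def by (intro analytic_intros W.analytic)
        hence "zorder H z = 0" using 3 H0 by (intro zorder_eq_0I) (auto simp: Z_def)
        thus ?thesis using ord0[OF 3] by simp
      qed
    qed
  qed
qed

text \<open>
  The quotient of \<open>f\<close> by an entire function \<open>H\<close> with the same zeros is \<open>exp g\<close> with \<open>g\<close> entire. Exact
  division preserves the growth class, so \<open>Re g\<close> grows at most like a power and \<open>g\<close> is a polynomial.
\<close>
lemma Hadamard_factorization:
  fixes f :: "complex \<Rightarrow> complex" and l s t :: real
  assumes f: "growth_le t f" "f z0 \<noteq> 0" and "0 < l" "l < s" "s \<le> t" and "r0 \<ge> 1"
    and count: "\<And>r. r \<ge> r0 \<Longrightarrow> real (pole_count r (\<lambda>z. 1 / f z)) \<le> r powr l"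
  obtains H p where "growth_le s H" "\<And>z. f z = H z * exp (poly p z)"
proof -
  have hol: "f holomorphic_on UNIV" by (rule growth_le_holomorphic[OF f(1)])
  obtain H where H: "growth_le s H" "\<And>z. H z = 0 \<longleftrightarrow> f z = 0" "\<And>z. zorder H z = zorder f z"
    using entire_with_same_zeros_growth_le[OF hol f(2) assms(3,4,6) count] by blast
  have holH: "H holomorphic_on UNIV" by (rule growth_le_holomorphic[OF H(1)])
  obtain h where h: "h holomorphic_on UNIV" "\<And>z. h z \<noteq> 0" "\<And>z. f z = h z * H z"
    using holomorphic_zorder_factorization[OF hol open_UNIV connected_UNIV holH] H by auto
  have "t \<ge> 0" using assms(3,4,5) by linarith
  have "H z0 \<noteq> 0" using H(2) f(2) by blast
  have ht: "growth_le t h"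
    by (rule growth_le_quotient[OF growth_le_mono[OF H(1) \<open>s \<le> t\<close>] f(1) h(1) \<open>t \<ge> 0\<close> h(3)[symmetric] \<open>H z0 \<noteq> 0\<close>])
  obtain g where g: "g holomorphic_on UNIV" "\<And>z. h z = exp (g z)"
    by (rule holomorphic_logarithm_exists[OF convex_UNIV open_UNIV h(1), of 0]) (use h(2) in auto)
  obtain C where C: "\<And>z. norm (h z) \<le> exp (C * (1 + norm z) powr t)"
    using growth_leE[OF ht] by blast
  have "Re (g z) \<le> C * (1 + norm z) powr t" for z using C[of z] by (simp add: g(2))
  then obtain p where "g = poly p"
    using entire_Re_bound_imp_poly[OF g(1), of t C] \<open>t \<ge> 0\<close> by blast
  thus ?thesis using that[OF H(1), of p] g(2) h(3) by (simp add: mult.commute)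
qed

section \<open>The difference equation\<close>

text \<open>
  When the growth of \<open>H\<close> stays strictly below the order of \<open>f\<close>, the exponential alone determines that
  order; if the order were smaller than \<open>degree p\<close>, then \<open>exp p = f / H\<close> would grow too slowly. In
  particular the order is an integer.
\<close>
lemma growth_order_eq_degree:
  fixes s :: real
  assumes H: "growth_le s H" and fH: "\<And>z. f z = H z * exp (poly p z)"
    and s: "s \<ge> 0" "ereal s < growth_order f" and f0: "f z0 \<noteq> 0"
  shows "growth_order f = ereal (real (degree p))" and "s < real (degree p)"
proof -
  have hol: "f holomorphic_on UNIV"
    unfolding fH by (intro holomorphic_intros growth_le_holomorphic[OF H])
  have "growth_le (max s (real (degree p))) f"
    unfolding fH by (intro growth_le_mult growth_le_exp_poly growth_le_mono[OF H]) auto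
  hence "growth_order f \<le> ereal (max s (real (degree p)))"
    using s by (intro growth_le_imp_growth_order_le) auto
  hence "ereal s < ereal (max s (real (degree p)))" "growth_order f \<le> ereal (max s (real (degree p)))"
    using s(2) less_le_trans by blast+
  hence le: "growth_order f \<le> ereal (real (degree p))" "s < real (degree p)"
    by (auto simp: max_def split: if_splits)
  have "\<not> growth_order f < ereal (real (degree p))"
  proof
    assume "growth_order f < ereal (real (degree p))"
    then obtain t where t: "growth_order f < ereal t" "t < real (degree p)"
      using ereal_dense2[of "growth_order f" "ereal (real (degree p))"] by auto
    have "s < t" using s(2) t(1) by (metis less_ereal.simps(1) less_trans)
    have "growth_le t f" by (rule growth_order_less_imp_growth_le[OF hol t(1)]) (use s \<open>s < t\<close> in auto)
    have "degree p \<le> t"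
      by (rule exp_poly_mult_growth_le_imp_degree_le[OF growth_le_mono[OF H less_imp_le[OF \<open>s < t\<close>]] \<open>growth_le t f\<close>, where a = z0])
         (use s \<open>s < t\<close> f0 in \<open>auto simp: fH\<close>)
    thus False using t(2) by simp
  qed
  thus "growth_order f = ereal (real (degree p))" "s < real (degree p)" using le by auto
qed

lemma two_exponentials_neq_0:
  fixes a b :: complex
  assumes "a \<noteq> b" "p \<noteq> 0"
  obtains z where "p * exp (a * z) + q * exp (b * z) \<noteq> 0"
proof (rule ccontr)
  assume "\<not> thesis"
  with that have 0: "p * exp (a * z) + q * exp (b * z) = 0" for z by blast
  have "(if True then p else q) = 0"
  proof (rule Borel_exponential_independence[where I = UNIV and s = "1 / 2" and j = True
        and G = "\<lambda>i z. if i then p else q" and g = "\<lambda>i. if i then [:0, a:] else [:0, b:]"])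
    show "(\<Sum>i\<in>UNIV. (if i then p else q) * exp (poly (if i then [:0, a:] else [:0, b:]) z)) = 0" for z
      using 0[of z] by (simp add: UNIV_bool mult.commute add.commute)
  qed (use assms(1) in auto)
  thus False using assms by simp
qed

text \<open>
  Insert the Hadamard factorization \<open>f = H exp a\<close>; the equation becomes
  \<open>A exp (n a) + B exp k = P\<close> with \<open>k(z) = Q(z) + a(z + c)\<close>, where \<open>H\<close>, and with it \<open>A\<close> and \<open>B\<close>, grows
  more slowly than \<open>exp a\<close>. Suppose \<open>degree a \<ge> 2\<close>, so that \<open>P\<close> is also of slower growth. Since \<open>P\<close> is
  not identically zero, Borel's theorem for the exponent \<open>0\<close> shows that \<open>k\<close> has low degree; then \<open>n a\<close> is
  separated from both \<open>k\<close> and \<open>0\<close>, whence \<open>A = 0\<close>. This says \<open>f + w f' = 0\<close>, so \<open>f\<close> is a multiple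
  of \<open>exp (-z/w)\<close> and has order one after all. Knowing that \<open>f\<close> has growth at most \<open>1\<close>, the equation
  exhibits \<open>q(z) f(z + c) exp Q\<close> as a function of growth at most \<open>1\<close>, so \<open>Q\<close> is linear.
\<close>
lemma order_one_of_difference_equation:
  fixes w c :: complex and f P :: "complex \<Rightarrow> complex"
  assumes "n \<ge> 1" "w \<noteq> 0" "q \<noteq> 0" "degree Q > 0"
    and P: "growth_le 1 P" "P z1 \<noteq> 0"
    and f: "growth_order f < \<infinity>" "f holomorphic_on UNIV" "f z0 \<noteq> 0"
    and eq: "\<And>z. f z ^ n + w * f z ^ (n - 1) * deriv f z + poly q z * exp (poly Q z) * f (z + c) = P z"
    and lam: "zero_exponent f < growth_order f"
  shows "growth_order f = ereal (real (degree Q))" "degree Q = 1"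
proof -
  obtain l where l: "zero_exponent f < ereal l" "ereal l < growth_order f"
    using ereal_dense2[OF lam] by blast
  obtain s where s: "l < s" "ereal s < growth_order f"
    using ereal_dense2[OF l(2)] by auto
  have "0 < l" using l(1) zero_exponent_nonneg[of f] by (metis ereal_less(2) le_less_trans)
  hence "s > 0" using s by simp
  obtain t where t: "growth_order f < ereal t"
    using ereal_dense2[OF f(1)] by blast
  hence "s < t" using s(2) by (metis less_ereal.simps(1) less_trans)
  obtain r0 where r0: "r0 \<ge> 1" "\<And>r. r \<ge> r0 \<Longrightarrow> real (pole_count r (\<lambda>z. 1 / f z)) \<le> r powr l"
    using zero_exponent_less_imp_count_le[OF l(1)] by blast
  have "growth_le t f" by (rule growth_order_less_imp_growth_le[OF f(2) t]) (use \<open>s > 0\<close> \<open>s < t\<close> in auto)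
  then obtain H a where H: "growth_le s H" and fH: "\<And>z. f z = H z * exp (poly a z)"
    using Hadamard_factorization[OF _ f(3) \<open>0 < l\<close> \<open>l < s\<close> _ r0] \<open>s < t\<close> by (metis less_imp_le)
  have order: "growth_order f = ereal (real (degree a))" and "s < degree a"
    using growth_order_eq_degree[OF H fH _ s(2) f(3)] \<open>s > 0\<close> by auto
  have dega: "degree a \<ge> 1" using \<open>s < degree a\<close> \<open>s > 0\<close> by linarith
  have H0: "H z0 \<noteq> 0" using f(3) fH by auto
  have holH [holomorphic_intros]: "H holomorphic_on A" for A by (rule growth_le_holomorphic[OF H])

  define B where "B = (\<lambda>z. poly q z * H (z + c))"
  have B: "growth_le r B" if "r \<ge> s" for r
    unfolding B_def using that \<open>s > 0\<close>
    by (intro growth_le_mult growth_le_shift growth_le_poly growth_le_mono[OF H]) auto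
  obtain zq where zq: "poly q zq \<noteq> 0" using \<open>q \<noteq> 0\<close> poly_all_0_iff_0 by blast
  have shift_hol: "(\<lambda>z. g (z + c)) holomorphic_on UNIV" if "g holomorphic_on UNIV" for g :: "complex \<Rightarrow> complex"
    by (rule holomorphic_on_compose_gen[of "\<lambda>z. z + c" _ g UNIV, unfolded o_def]) (auto intro!: holomorphic_intros that)
  have "\<exists>z. B z \<noteq> 0"
  proof (rule ccontr)
    assume "\<nexists>z. B z \<noteq> 0"
    hence "H (z + c) * poly q z = 0" for z by (auto simp: B_def)
    hence "H (z0 - c + c) = 0"
      by (rule entire_mult_eq_0[where F = "\<lambda>z. H (z + c)" and G = "poly q" and a = zq, rotated 2])
         (use zq shift_hol[OF holH] in \<open>auto intro!: holomorphic_intros\<close>)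
    thus False using H0 by simp
  qed
  then obtain zB where zB: "B zB \<noteq> 0" by blast

  define ac where "ac = pcompose a [:c, 1:]"
  have ac: "poly ac z = poly a (z + c)" for z by (simp add: ac_def poly_pcompose add.commute)
  have degac: "degree ac = degree a" by (simp add: ac_def degree_pcompose)
  define k where "k = Q + ac"

  have "degree a = 1"
  proof (rule ccontr)
    assume "degree a \<noteq> 1"
    hence dega2: "degree a \<ge> 2" using dega by simp
    \<comment> \<open>The growth class that contains \<open>H\<close> as well as \<open>P\<close>, still below the degree of \<open>a\<close>.\<close>
    define r where "r = max s 1"
    have r: "r \<ge> s" "r \<ge> 1" "r > 0" "r < degree a" using dega2 \<open>s < degree a\<close> by (auto simp: r_def)
    define A where "A = (\<lambda>z. H z ^ n + w * H z ^ (n - 1) * (deriv H z + poly (pderiv a) z * H z))"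
    have Hr: "growth_le r H" by (rule growth_le_mono[OF H r(1)])
    have A: "growth_le r A"
      unfolding A_def using r
      by (intro growth_le_add growth_le_mult growth_le_power growth_le_deriv growth_le_poly growth_le_const Hr) auto
    have f': "deriv f z = (deriv H z + poly (pderiv a) z * H z) * exp (poly a z)" for z
    proof -
      have "((\<lambda>z. H z * exp (poly a z)) has_field_derivative (deriv H z + poly (pderiv a) z * H z) * exp (poly a z)) (at z)"
        by (auto intro!: derivative_eq_intros holomorphic_derivI[OF holH open_UNIV UNIV_I] simp: algebra_simps)
      moreover have "f = (\<lambda>z. H z * exp (poly a z))" using fH by auto
      ultimately show ?thesis by (simp add: DERIV_imp_deriv)
    qed
    have eq': "A z * exp (poly (of_nat n * a) z) + B z * exp (poly k z) - P z = 0" for z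
    proof -
      have "exp (poly (of_nat n * a) z) = exp (poly a z) ^ n" by (simp add: exp_of_nat_mult of_nat_poly)
      moreover have "exp (poly a z) ^ n = exp (poly a z) ^ (n - 1) * exp (poly a z)"
        using \<open>n \<ge> 1\<close> by (metis One_nat_def Suc_pred less_eq_Suc_le mult.commute power_Suc)
      ultimately have "A z * exp (poly (of_nat n * a) z) = f z ^ n + w * f z ^ (n - 1) * deriv f z"
        unfolding f' fH A_def by (simp add: power_mult_distrib algebra_simps)
      moreover have "B z * exp (poly k z) = poly q z * exp (poly Q z) * f (z + c)"
        by (simp add: B_def k_def fH ac exp_add mult_ac)
      ultimately show ?thesis using eq[of z] by simp
    qed
    \<comment> \<open>Borel's theorem is applied to the three summands with exponents \<open>n a\<close>, \<open>k\<close> and \<open>0\<close>.\<close>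
    define G where "G = (\<lambda>i::nat. if i = 0 then A else if i = 1 then B else (\<lambda>z. - P z))"
    define g where "g = (\<lambda>i::nat. if i = 0 then of_nat n * a else if i = 1 then k else 0)"
    have Gg: "G j z = 0" if "j < 3" "\<And>i. i < 3 \<Longrightarrow> i \<noteq> j \<Longrightarrow> degree (g i - g j) > r" for j z
    proof (rule Borel_exponential_independence[where I = "{..<3}" and G = G and g = g and s = r])
      show "growth_le r (G i)" for i
        using A B[OF r(1)] growth_le_uminus[OF growth_le_mono[OF P(1) r(2)]] by (auto simp: G_def)
      show "(\<Sum>i<3. G i z * exp (poly (g i) z)) = 0" for z
        using eq'[of z] by (simp add: numeral_3_eq_3 G_def g_def)
    qed (use that r in auto)
    have degna: "degree (of_nat n * a) = degree a"
      using \<open>n \<ge> 1\<close> by (simp add: of_nat_poly)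
    have three: "i = 0 \<or> i = 1 \<or> i = 2" if "i < 3" for i :: nat using that by auto
    have "degree k \<le> r"
    proof (rule ccontr)
      assume k: "\<not> degree k \<le> r"
      have "G 2 z1 = 0"
      proof (rule Gg)
        fix i :: nat assume "i < 3" "i \<noteq> 2"
        thus "degree (g i - g 2) > r" using three[of i] k degna r by (auto simp: g_def)
      qed auto
      thus False using P(2) by (simp add: G_def)
    qed
    have degnak: "degree (of_nat n * a - k) > r"
    proof (rule ccontr)
      assume "\<not> degree (of_nat n * a - k) > r"
      hence "degree ((of_nat n * a - k) + k) \<le> r"
        using degree_add_le_max[of "of_nat n * a - k" k] \<open>degree k \<le> r\<close> by linarith
      thus False using degna r by simp
    qed
    have A0: "A z = 0" for z
    proof -
      have "G 0 z = 0"
      proof (rule Gg)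
        fix i :: nat assume "i < 3" "i \<noteq> 0"
        moreover have "degree (k - of_nat n * a) = degree (of_nat n * a - k)"
          by (metis degree_minus minus_diff_eq)
        ultimately show "degree (g i - g 0) > r"
          using three[of i] degnak degna r by (auto simp: g_def)
      qed auto
      thus ?thesis by (simp add: G_def)
    qed
    have "(H z + w * (deriv H z + poly (pderiv a) z * H z)) = 0" for z
    proof (rule entire_mult_eq_0[where G = "\<lambda>z. H z ^ (n - 1)"
          and F = "\<lambda>z. H z + w * (deriv H z + poly (pderiv a) z * H z)"])
      show "(H z + w * (deriv H z + poly (pderiv a) z * H z)) * H z ^ (n - 1) = 0" for z
      proof -
        have "H z ^ n = H z ^ (n - 1) * H z"
          using \<open>n \<ge> 1\<close> by (metis One_nat_def Suc_pred less_eq_Suc_le mult.commute power_Suc)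
        thus ?thesis using A0[of z] by (simp add: A_def algebra_simps)
      qed
      show "H z0 ^ (n - 1) \<noteq> 0" using H0 by simp
    qed (intro holomorphic_intros holomorphic_deriv; simp)+
    hence ode: "f z + w * deriv f z = 0" for z
      unfolding f' fH by (metis (no_types, lifting) distrib_right mult.assoc mult_zero_left)
    have "\<exists>C. \<forall>z. f z = C * exp (- z / w)"
    proof -
      have d: "deriv (\<lambda>z. exp (- z / w)) z = - exp (- z / w) / w" for z
        by (rule DERIV_imp_deriv) (use \<open>w \<noteq> 0\<close> in \<open>auto intro!: derivative_eq_intros\<close>)
      have d': "deriv f z * exp (- z / w) = f z * deriv (\<lambda>z. exp (- z / w)) z" for z
      proof -
        have "deriv f z = - f z / w" using ode[of z] \<open>w \<noteq> 0\<close> by (simp add: field_simps add_eq_0_iff)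
        thus ?thesis unfolding d by simp
      qed
      have "(\<lambda>z. exp (- z / w)) holomorphic_on UNIV" using \<open>w \<noteq> 0\<close> by (intro holomorphic_intros)
      from entire_proportional[OF f(2) this _ d', of 0] show ?thesis by auto
    qed
    then obtain C where fC: "\<And>z. f z = C * exp (- z / w)" by blast
    have "growth_le 1 (\<lambda>z. C * exp (poly [:0, - 1 / w:] z))"
      by (intro growth_le_mult growth_le_exp_poly growth_le_const) auto
    moreover have "f = (\<lambda>z. C * exp (poly [:0, - 1 / w:] z))" using fC by auto
    ultimately have "growth_le 1 f" by simp
    hence "growth_order f \<le> ereal 1" by (rule growth_le_imp_growth_order_le) simp
    thus False using order dega2 by simp
  qed
  have f1: "growth_le 1 f"
  proof -
    have "growth_le 1 (\<lambda>z. H z * exp (poly a z))"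
      by (intro growth_le_mult growth_le_exp_poly growth_le_mono[OF H])
         (use \<open>degree a = 1\<close> \<open>s < degree a\<close> in auto)
    moreover have "f = (\<lambda>z. H z * exp (poly a z))" using fH by auto
    ultimately show ?thesis by simp
  qed
  have "degree Q \<le> (1 :: real)"
  proof (rule exp_poly_mult_growth_le_imp_degree_le)
    show "growth_le 1 (\<lambda>z. poly q z * f (z + c))"
      by (intro growth_le_mult growth_le_shift growth_le_poly f1) auto
    show "growth_le 1 (\<lambda>z. P z - f z ^ n - w * f z ^ (n - 1) * deriv f z)"
      by (intro growth_le_diff growth_le_mult growth_le_power growth_le_deriv growth_le_const f1 P(1)) auto
    show "poly q z * f (z + c) * exp (poly Q z) = P z - f z ^ n - w * f z ^ (n - 1) * deriv f z" for z
      using eq[of z] by (simp add: algebra_simps)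
    show "poly q zB * f (zB + c) \<noteq> 0" using zB by (auto simp: B_def fH)
  qed auto
  thus Q1: "degree Q = 1" using \<open>degree Q > 0\<close> by simp
  show "growth_order f = ereal (real (degree Q))" using order \<open>degree a = 1\<close> Q1 by simp
qed

text \<open>
  For \<open>f = exp a\<close> the equation is a relation between four exponentials with polynomial coefficients and the
  exponents \<open>n a\<close>, \<open>k(z) = Q(z) + a(z + c)\<close>, \<open>\<alpha>\<^sub>1 z\<close> and \<open>\<alpha>\<^sub>2 z\<close>. Polynomials have growth at most \<open>1/2\<close>, so by
  Borel's theorem an exponent with a nonzero coefficient agrees with another one up to a constant.
  Neither \<open>\<alpha>\<^sub>1 z\<close> nor \<open>\<alpha>\<^sub>2 z\<close> can be matched with the other, and \<open>n a\<close> and \<open>k\<close> can each be matched with only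
  one of the two. The two possible matchings are the two alternatives of the conclusion.
\<close>
lemma exponential_solution_of_difference_equation:
  fixes w c p\<^sub>1 p\<^sub>2 \<alpha>\<^sub>1 \<alpha>\<^sub>2 :: complex and q Q a :: "complex poly" and f :: "complex \<Rightarrow> complex"
  assumes "n \<ge> 1" "p\<^sub>1 \<noteq> 0" "p\<^sub>2 \<noteq> 0" "\<alpha>\<^sub>1 \<noteq> \<alpha>\<^sub>2"
    and fa: "\<And>z. f z = exp (poly a z)"
    and eq: "\<And>z. f z ^ n + w * f z ^ (n - 1) * deriv f z + poly q z * exp (poly Q z) * f (z + c)
              = p\<^sub>1 * exp (\<alpha>\<^sub>1 * z) + p\<^sub>2 * exp (\<alpha>\<^sub>2 * z)"
  shows "(\<exists>\<beta> b. (\<forall>z. f z = exp (\<alpha>\<^sub>2 * z / of_nat n + \<beta>)) \<and>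
                   (\<forall>z. poly Q z = (\<alpha>\<^sub>1 - \<alpha>\<^sub>2 / of_nat n) * z + b)) \<or>
            (\<exists>\<beta> b. (\<forall>z. f z = exp (\<alpha>\<^sub>1 * z / of_nat n + \<beta>)) \<and>
                   (\<forall>z. poly Q z = (\<alpha>\<^sub>2 - \<alpha>\<^sub>1 / of_nat n) * z + b))"
proof -
  define k where "k = Q + pcompose a [:c, 1:]"
  have f': "deriv f z = poly (pderiv a) z * exp (poly a z)" for z
  proof -
    have "((\<lambda>z. exp (poly a z)) has_field_derivative poly (pderiv a) z * exp (poly a z)) (at z)"
      by (auto intro!: derivative_eq_intros)
    moreover have "f = (\<lambda>z. exp (poly a z))" using fa by auto
    ultimately show ?thesis by (simp add: DERIV_imp_deriv)
  qed
  define G where "G = (\<lambda>i::nat. if i = 0 then 1 + smult w (pderiv a) else if i = 1 then q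
                        else if i = 2 then [:-p\<^sub>1:] else [:-p\<^sub>2:])"
  define g where "g = (\<lambda>i::nat. if i = 0 then of_nat n * a else if i = 1 then k
                        else if i = 2 then [:0, \<alpha>\<^sub>1:] else [:0, \<alpha>\<^sub>2:])"
  have sum0: "(\<Sum>i<4. poly (G i) z * exp (poly (g i) z)) = 0" for z
  proof -
    have "exp (poly (of_nat n * a) z) = exp (poly a z) ^ n" by (simp add: exp_of_nat_mult of_nat_poly)
    moreover have "exp (poly a z) ^ n = exp (poly a z) ^ (n - 1) * exp (poly a z)"
      using \<open>n \<ge> 1\<close> by (metis One_nat_def Suc_pred less_eq_Suc_le mult.commute power_Suc)
    ultimately have "poly (G 0) z * exp (poly (g 0) z) = f z ^ n + w * f z ^ (n - 1) * deriv f z"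
      unfolding f' fa by (simp add: G_def g_def algebra_simps)
    moreover have "poly (G 1) z * exp (poly (g 1) z) = poly q z * exp (poly Q z) * f (z + c)"
      by (simp add: G_def g_def k_def fa exp_add poly_pcompose add.commute mult_ac)
    moreover have "poly (G 2) z * exp (poly (g 2) z) + poly (G 3) z * exp (poly (g 3) z)
        = - (p\<^sub>1 * exp (\<alpha>\<^sub>1 * z) + p\<^sub>2 * exp (\<alpha>\<^sub>2 * z))"
      by (simp add: G_def g_def mult.commute)
    moreover have "(\<Sum>i<4. poly (G i) z * exp (poly (g i) z)) =
        poly (G 0) z * exp (poly (g 0) z) + poly (G 1) z * exp (poly (g 1) z)
        + (poly (G 2) z * exp (poly (g 2) z) + poly (G 3) z * exp (poly (g 3) z))"
      by (simp add: eval_nat_numeral)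
    ultimately show ?thesis using eq[of z] by simp
  qed
  have match: "\<exists>i<4. i \<noteq> j \<and> degree (g i - g j) = 0" if "j < 4" "poly (G j) 0 \<noteq> 0" for j
  proof (rule ccontr)
    assume "\<not> (\<exists>i<4. i \<noteq> j \<and> degree (g i - g j) = 0)"
    hence "degree (g i - g j) > 0" if "i < 4" "i \<noteq> j" for i using that by auto
    hence "poly (G j) 0 = 0"
      by (intro Borel_exponential_independence[where I = "{..<4}" and G = "\<lambda>i. poly (G i)" and g = g and s = "1/2"])
         (use that sum0 in \<open>force simp: Suc_le_eq\<close>)+
    thus False using that by simp
  qed
  have four: "i = 0 \<or> i = 1 \<or> i = 2 \<or> i = 3" if "i < 4" for i :: nat using that by auto
  have m1: "degree (of_nat n * a - [:0, \<alpha>\<^sub>1:]) = 0 \<or> degree (k - [:0, \<alpha>\<^sub>1:]) = 0"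
  proof -
    obtain i where "i < 4" "i \<noteq> 2" "degree (g i - g 2) = 0" using match[of 2] assms by (auto simp: G_def)
    thus ?thesis using four[of i] \<open>\<alpha>\<^sub>1 \<noteq> \<alpha>\<^sub>2\<close> by (auto simp: g_def)
  qed
  have m2: "degree (of_nat n * a - [:0, \<alpha>\<^sub>2:]) = 0 \<or> degree (k - [:0, \<alpha>\<^sub>2:]) = 0"
  proof -
    obtain i where "i < 4" "i \<noteq> 3" "degree (g i - g 3) = 0" using match[of 3] assms by (auto simp: G_def)
    thus ?thesis using four[of i] \<open>\<alpha>\<^sub>1 \<noteq> \<alpha>\<^sub>2\<close> by (auto simp: g_def)
  qed
  have diff_cancel_left: "y - x = (h - x) - (h - y)" for x y h :: "complex poly"
    by (simp add: algebra_simps)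
  have no: "\<not> (degree (h - [:0, \<alpha>\<^sub>1:]) = 0 \<and> degree (h - [:0, \<alpha>\<^sub>2:]) = 0)" for h :: "complex poly"
  proof
    assume "degree (h - [:0, \<alpha>\<^sub>1:]) = 0 \<and> degree (h - [:0, \<alpha>\<^sub>2:]) = 0"
    then obtain u v where "h - [:0, \<alpha>\<^sub>1:] = [:u:]" "h - [:0, \<alpha>\<^sub>2:] = [:v:]"
      by (metis degree_eq_zeroE)
    hence "[:0, \<alpha>\<^sub>2:] - [:0, \<alpha>\<^sub>1:] = [:u:] - [:v:]"
      using diff_cancel_left[of "[:0, \<alpha>\<^sub>2:]" "[:0, \<alpha>\<^sub>1:]" h] by (simp only:)
    thus False using \<open>\<alpha>\<^sub>1 \<noteq> \<alpha>\<^sub>2\<close> by simp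
  qed
  have conclude: "\<exists>\<beta> b. (\<forall>z. f z = exp (\<alpha> * z / of_nat n + \<beta>)) \<and>
                   (\<forall>z. poly Q z = (\<alpha>' - \<alpha> / of_nat n) * z + b)"
    if d: "degree (of_nat n * a - [:0, \<alpha>:]) = 0" "degree (k - [:0, \<alpha>':]) = 0" for \<alpha> \<alpha>'
  proof -
    from d obtain u v where u: "of_nat n * a - [:0, \<alpha>:] = [:u:]" and v: "k - [:0, \<alpha>':] = [:v:]"
      by (metis degree_eq_zeroE)
    have pa: "poly a z = \<alpha> * z / of_nat n + u / of_nat n" for z
    proof -
      have "poly (of_nat n * a - [:0, \<alpha>:]) z = u" by (simp add: u)
      thus ?thesis using \<open>n \<ge> 1\<close> by (simp add: of_nat_poly field_simps)
    qed
    have "poly Q z = (\<alpha>' - \<alpha> / of_nat n) * z + (v - \<alpha> * c / of_nat n - u / of_nat n)" for z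
    proof -
      have "poly (k - [:0, \<alpha>':]) z = v" by (simp add: v)
      hence "poly Q z = \<alpha>' * z + v - poly a (z + c)" by (simp add: k_def poly_pcompose algebra_simps)
      also have "\<dots> = (\<alpha>' - \<alpha> / of_nat n) * z + (v - \<alpha> * c / of_nat n - u / of_nat n)"
        unfolding pa by (simp add: add_divide_distrib diff_divide_distrib algebra_simps)
      finally show ?thesis .
    qed
    thus ?thesis using fa pa by metis
  qed
  show ?thesis using m1 m2 no[of "of_nat n * a"] no[of k] conclude by blast
qed

theorem theorem5:
  fixes n :: nat
    and w c p\<^sub>1 p\<^sub>2 \<alpha>\<^sub>1 \<alpha>\<^sub>2 :: complex
    and q Q :: "complex poly"
    and f :: "complex \<Rightarrow> complex"
  assumes "n \<ge> 1"
    and "w \<noteq> 0" "c \<noteq> 0" "p\<^sub>1 \<noteq> 0" "p\<^sub>2 \<noteq> 0" "\<alpha>\<^sub>1 \<noteq> 0" "\<alpha>\<^sub>2 \<noteq> 0"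
    and "\<alpha>\<^sub>1 \<noteq> \<alpha>\<^sub>2"
    and "q \<noteq> 0"
    and "degree Q > 0"
    and "transcendental_entire f"
    and "growth_order f < \<infinity>"
    and "\<And>z. f z ^ n + w * f z ^ (n - 1) * deriv f z + poly q z * exp (poly Q z) * f (z + c)
              = p\<^sub>1 * exp (\<alpha>\<^sub>1 * z) + p\<^sub>2 * exp (\<alpha>\<^sub>2 * z)"
    and "zero_exponent f < growth_order f"
  shows "(n = 3 \<or> n = 2 \<longrightarrow> growth_order f = ereal (real (degree Q)) \<and> degree Q = 1) \<and>
         (f \<in> \<Gamma>\<^sub>0 \<longrightarrow>
            (\<exists>\<beta> b. (\<forall>z. f z = exp (\<alpha>\<^sub>2 * z / of_nat n + \<beta>)) \<and>
                   (\<forall>z. poly Q z = (\<alpha>\<^sub>1 - \<alpha>\<^sub>2 / of_nat n) * z + b)) \<or>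
            (\<exists>\<beta> b. (\<forall>z. f z = exp (\<alpha>\<^sub>1 * z / of_nat n + \<beta>)) \<and>
                   (\<forall>z. poly Q z = (\<alpha>\<^sub>2 - \<alpha>\<^sub>1 / of_nat n) * z + b)))"
proof (intro conjI impI)
  have hol: "f holomorphic_on UNIV" using assms(11) by (simp add: transcendental_entire_def)
  obtain z0 where z0: "f z0 \<noteq> 0"
  proof (rule ccontr)
    assume "\<not> thesis"
    with that have "f = poly 0" by fastforce
    thus False using assms(11) unfolding transcendental_entire_def by blast
  qed
  obtain z1 where z1: "p\<^sub>1 * exp (\<alpha>\<^sub>1 * z1) + p\<^sub>2 * exp (\<alpha>\<^sub>2 * z1) \<noteq> 0"
    using two_exponentials_neq_0[OF assms(8,4)] by blast
  have "growth_le 1 (\<lambda>z. p\<^sub>1 * exp (poly [:0, \<alpha>\<^sub>1:] z) + p\<^sub>2 * exp (poly [:0, \<alpha>\<^sub>2:] z))"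
    by (intro growth_le_add growth_le_mult growth_le_exp_poly growth_le_const) auto
  hence P: "growth_le 1 (\<lambda>z. p\<^sub>1 * exp (\<alpha>\<^sub>1 * z) + p\<^sub>2 * exp (\<alpha>\<^sub>2 * z))" by (simp add: mult.commute)
  note * = order_one_of_difference_equation[OF assms(1,2,9,10) P z1 assms(12) hol z0 assms(13,14)]
  show "growth_order f = ereal (real (degree Q))" "degree Q = 1" by (rule *)+
next
  assume "f \<in> \<Gamma>\<^sub>0"
  then obtain a where "\<And>z. f z = exp (poly a z)" by (auto simp: \<Gamma>\<^sub>0_def)
  from exponential_solution_of_difference_equation[OF assms(1,4,5,8) this assms(13)]
  show "(\<exists>\<beta> b. (\<forall>z. f z = exp (\<alpha>\<^sub>2 * z / of_nat n + \<beta>)) \<and>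
                   (\<forall>z. poly Q z = (\<alpha>\<^sub>1 - \<alpha>\<^sub>2 / of_nat n) * z + b)) \<or>
            (\<exists>\<beta> b. (\<forall>z. f z = exp (\<alpha>\<^sub>1 * z / of_nat n + \<beta>)) \<and>
                   (\<forall>z. poly Q z = (\<alpha>\<^sub>2 - \<alpha>\<^sub>1 / of_nat n) * z + b))" .
qed

end
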